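(* Let $(V,\lambda)$ define an almost Riemann soliton on the $n$-dimensional Riemannian manifold $(M,g)$, $n\geq 3$, with torse-forming potential vector field $V$, i.e. $\nabla V=aI+\psi\otimes V$ with $a$ a smooth function and $\psi$ a $1$-form on $M$. Let $\zeta$ be the vector field $g$-dual to $\psi$. If $R(V,\cdot)\cdot\operatorname{Ric}=0$, then $$\lambda=\frac12\cdot\frac{V(|V|^2)}{|V|^2}+a,\quad\text{or}\quad a=\frac12\cdot\frac{V(|V|^2)}{|V|^2}\pm|V|\cdot|\zeta|.$$
   Context: Conventions: for $(0,2)$-tensor fields, $(T_1\odot T_2)(X,Y,Z,W)=T_1(X,W)T_2(Y,Z)+T_1(Y,Z)T_2(X,W)-T_1(X,Z)T_2(Y,W)-T_1(Y,W)T_2(X,Z)$ (Kulkarni-Nomizu product). $\nabla$ is the Levi-Civita connection, $R(X,Y)Z=\nabla_X\nabla_YZ-\nabla_Y\nabla_XZ-\nabla_{[X,Y]}Z$, $R(X,Y,Z,W)=g(R(X,Y)Z,W)$, and $\operatorname{Ric}(Y,Z)$ is the trace of $X\mapsto R(X,Y)Z$. $G:=\frac12 g\odot g$. For a non-vanishing (nowhere zero) smooth vector field $V$ and a smooth function $\lambda$ on $M$, $(V,\lambda)$ defines an almost Riemann soliton (with potential vector field $V$) if $\frac12(\pounds_Vg)\odot g+R=\lambda G$, where $\pounds_V$ is the Lie derivative in the direction of $V$. $I$ is the identity endomorphism on vector fields; $\nabla V=aI+\psi\otimes V$ means $\nabla_XV=aX+\psi(X)V$ for all $X$. $\zeta$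 is defined by $g(\zeta,X)=\psi(X)$. The condition $R(V,\cdot)\cdot\operatorname{Ric}=0$ means that $\operatorname{Ric}(R(V,X)Y,Z)+\operatorname{Ric}(Y,R(V,X)Z)=0$ for all vector fields $X,Y,Z$ on $M$. *)

theory Defs
  imports "HOL-Analysis.Analysis" "HOL-Library.Function_Algebras"
begin

text \<open>Pointwise real vector space structure on functions. It is used both for tangent vectors
  (functionals on scalar functions) and for vector fields.\<close>

instantiation "fun" :: (type, real_vector) real_vector
begin

definition scaleR_fun :: "real \<Rightarrow> ('a \<Rightarrow> 'b) \<Rightarrow> 'a \<Rightarrow> 'b" where
  "scaleR_fun c f = (\<lambda>x. c *\<^sub>R f x)"

instance
  by standard (auto simp: scaleR_fun_def fun_eq_iff scaleR_add_right scaleR_add_left)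

end


section \<open>Smooth manifolds\<close>

primrec Ck_on :: "nat \<Rightarrow> 'a::euclidean_space set \<Rightarrow> ('a \<Rightarrow> 'b::real_normed_vector) \<Rightarrow> bool" where
  "Ck_on 0 S f \<longleftrightarrow> continuous_on S f"
| "Ck_on (Suc k) S f \<longleftrightarrow>
     (\<forall>x\<in>S. f differentiable (at x)) \<and>
     (\<forall>v. Ck_on k S (\<lambda>x. frechet_derivative f (at x) v))"

text \<open>Only used for open \<open>S\<close>.\<close>

definition smooth_on :: "'a::euclidean_space set \<Rightarrow> ('a \<Rightarrow> 'b::real_normed_vector) \<Rightarrow> bool" where
  "smooth_on S f \<longleftrightarrow> (\<forall>k. Ck_on k S f)"

type_synonym ('m, 'e) chart = "'m set \<times> ('m \<Rightarrow> 'e)"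

text \<open>The manifold is the whole type \<open>'m\<close>, its dimension is \<open>DIM('e)\<close>. The Hausdorff property and
  second countability are expressed by the type classes of \<open>'m\<close>.\<close>

definition smooth_atlas ::
  "('m::{t2_space,second_countable_topology}, 'e::euclidean_space) chart set \<Rightarrow> bool" where
  "smooth_atlas A \<longleftrightarrow>
     (\<Union>(U, \<phi>)\<in>A. U) = UNIV \<and>
     (\<forall>(U, \<phi>)\<in>A. open U \<and> open (\<phi> ` U) \<and> (\<exists>\<phi>'. homeomorphism U (\<phi> ` U) \<phi> \<phi>')) \<and>
     (\<forall>(U, \<phi>)\<in>A. \<forall>(W, \<theta>)\<in>A. smooth_on (\<phi> ` (U \<inter> W)) (\<theta> \<circ> inv_into U \<phi>))"

definition smooth_functions ::
  "('m::{t2_space,second_countable_topology}, 'e::euclidean_space) chart set \<Rightarrow> ('m \<Rightarrow> real) set" where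
  "smooth_functions A = {f. \<forall>(U, \<phi>)\<in>A. smooth_on (\<phi> ` U) (f \<circ> inv_into U \<phi>)}"


section \<open>Tangent vectors and vector fields\<close>

text \<open>A tangent vector at \<open>p\<close> is a derivation at \<open>p\<close> of the algebra of smooth functions. The value on
  non-smooth functions is fixed to be \<open>0\<close>, so that equality of tangent vectors is equality of
  functionals.\<close>

type_synonym 'm tangent_vector = "('m \<Rightarrow> real) \<Rightarrow> real"

type_synonym 'm field = "'m \<Rightarrow> 'm tangent_vector"

definition tangent_space ::
  "('m::{t2_space,second_countable_topology}, 'e::euclidean_space) chart set \<Rightarrow> 'm
     \<Rightarrow> 'm tangent_vector set" where
  "tangent_space A p = {v.
     (\<forall>f\<in>smooth_functions A. \<forall>h\<in>smooth_functions A.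
        v (\<lambda>q. f q + h q) = v f + v h \<and> v (\<lambda>q. f q * h q) = f p * v h + h p * v f) \<and>
     (\<forall>c. \<forall>f\<in>smooth_functions A. v (\<lambda>q. c * f q) = c * v f) \<and>
     (\<forall>f. f \<notin> smooth_functions A \<longrightarrow> v f = 0)}"

definition vector_fields ::
  "('m::{t2_space,second_countable_topology}, 'e::euclidean_space) chart set \<Rightarrow> 'm field set" where
  "vector_fields A = {X. (\<forall>p. X p \<in> tangent_space A p) \<and>
     (\<forall>f\<in>smooth_functions A. (\<lambda>p. X p f) \<in> smooth_functions A)}"

text \<open>For a non-smooth \<open>f\<close> both inner functions vanish identically, hence so does the bracket.\<close>

definition lie_bracket :: "'m field \<Rightarrow> 'm field \<Rightarrow> 'm field" where
  "lie_bracket X Y = (\<lambda>p f. X p (\<lambda>q. Y q f) - Y p (\<lambda>q. X q f))"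

definition one_form ::
  "('m::{t2_space,second_countable_topology}, 'e::euclidean_space) chart set
     \<Rightarrow> ('m \<Rightarrow> 'm tangent_vector \<Rightarrow> real) \<Rightarrow> bool" where
  "one_form A \<psi> \<longleftrightarrow>
     (\<forall>p. \<forall>u\<in>tangent_space A p. \<forall>v\<in>tangent_space A p. \<forall>c.
        \<psi> p (u + v) = \<psi> p u + \<psi> p v \<and> \<psi> p (c *\<^sub>R u) = c * \<psi> p u) \<and>
     (\<forall>X\<in>vector_fields A. (\<lambda>p. \<psi> p (X p)) \<in> smooth_functions A)"


section \<open>Riemannian metrics, connections and curvature\<close>

type_synonym 'm metric = "'m \<Rightarrow> 'm tangent_vector \<Rightarrow> 'm tangent_vector \<Rightarrow> real"

definition riemannian_metric ::
  "('m::{t2_space,second_countable_topology}, 'e::euclidean_space) chart set \<Rightarrow> 'm metric \<Rightarrow> bool" where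
  "riemannian_metric A g \<longleftrightarrow>
     (\<forall>p. \<forall>u\<in>tangent_space A p. \<forall>v\<in>tangent_space A p.
        g p u v = g p v u \<and> (u \<noteq> 0 \<longrightarrow> g p u u > 0) \<and>
        (\<forall>w\<in>tangent_space A p. g p (u + v) w = g p u w + g p v w) \<and>
        (\<forall>c. g p (c *\<^sub>R u) v = c * g p u v)) \<and>
     (\<forall>X\<in>vector_fields A. \<forall>Y\<in>vector_fields A. (\<lambda>p. g p (X p) (Y p)) \<in> smooth_functions A)"

definition metric_norm :: "'m metric \<Rightarrow> 'm \<Rightarrow> 'm tangent_vector \<Rightarrow> real" where
  "metric_norm g p v = sqrt (g p v v)"

text \<open>\<open>(0,k)\<close>-tensor fields are given by their values on vector fields.\<close>

type_synonym 'm tensor2 = "'m field \<Rightarrow> 'm field \<Rightarrow> 'm \<Rightarrow> real"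

type_synonym 'm tensor4 = "'m field \<Rightarrow> 'm field \<Rightarrow> 'm field \<Rightarrow> 'm field \<Rightarrow> 'm \<Rightarrow> real"

definition metric_tensor :: "'m metric \<Rightarrow> 'm tensor2" where
  "metric_tensor g = (\<lambda>X Y p. g p (X p) (Y p))"

type_synonym 'm connection = "'m field \<Rightarrow> 'm field \<Rightarrow> 'm field"

text \<open>\<open>D X Y\<close> stands for \<open>\<nabla>\<^sub>X Y\<close>; real linearity in \<open>Y\<close> is the Leibniz rule for constant \<open>f\<close>.\<close>

definition affine_connection ::
  "('m::{t2_space,second_countable_topology}, 'e::euclidean_space) chart set
     \<Rightarrow> 'm connection \<Rightarrow> bool" where
  "affine_connection A D \<longleftrightarrow>
     (\<forall>X\<in>vector_fields A. \<forall>Y\<in>vector_fields A.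
        D X Y \<in> vector_fields A \<and>
        (\<forall>Z\<in>vector_fields A. D (X + Y) Z = D X Z + D Y Z \<and> D X (Y + Z) = D X Y + D X Z) \<and>
        (\<forall>f\<in>smooth_functions A.
           D (\<lambda>p. f p *\<^sub>R X p) Y = (\<lambda>p. f p *\<^sub>R D X Y p) \<and>
           D X (\<lambda>p. f p *\<^sub>R Y p) = (\<lambda>p. X p f *\<^sub>R Y p + f p *\<^sub>R D X Y p)))"

definition levi_civita ::
  "('m::{t2_space,second_countable_topology}, 'e::euclidean_space) chart set \<Rightarrow> 'm metric
     \<Rightarrow> 'm connection \<Rightarrow> bool" where
  "levi_civita A g D \<longleftrightarrow> affine_connection A D \<and>
     (\<forall>X\<in>vector_fields A. \<forall>Y\<in>vector_fields A. D X Y - D Y X = lie_bracket X Y) \<and>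
     (\<forall>X\<in>vector_fields A. \<forall>Y\<in>vector_fields A. \<forall>Z\<in>vector_fields A. \<forall>p.
        X p (metric_tensor g Y Z) = metric_tensor g (D X Y) Z p + metric_tensor g Y (D X Z) p)"

definition curvature :: "'m connection \<Rightarrow> 'm field \<Rightarrow> 'm field \<Rightarrow> 'm field \<Rightarrow> 'm field" where
  "curvature D X Y Z = D X (D Y Z) - D Y (D X Z) - D (lie_bracket X Y) Z"

definition curvature_tensor :: "'m metric \<Rightarrow> 'm connection \<Rightarrow> 'm tensor4" where
  "curvature_tensor g D = (\<lambda>X Y Z W. metric_tensor g (curvature D X Y Z) W)"

text \<open>Trace of a linear endomorphism \<open>F\<close> of a finite-dimensional subspace \<open>S\<close>; it does not depend on
  the chosen basis.\<close>

definition trace_on :: "'v::real_vector set \<Rightarrow> ('v \<Rightarrow> 'v) \<Rightarrow> real" where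
  "trace_on S F = (let B = (SOME B. independent B \<and> span B = S)
                   in \<Sum>b\<in>B. representation B (F b) b)"

definition extend_vector ::
  "('m::{t2_space,second_countable_topology}, 'e::euclidean_space) chart set \<Rightarrow> 'm
     \<Rightarrow> 'm tangent_vector \<Rightarrow> 'm field" where
  "extend_vector A p v = (SOME X. X \<in> vector_fields A \<and> X p = v)"

text \<open>The trace is that of the endomorphism of the tangent space at \<open>p\<close> induced by
  \<open>X \<mapsto> R(X,Y)Z\<close>: every tangent vector extends to a vector field, and the value of
  \<open>R(X,Y)Z\<close> at \<open>p\<close> depends on \<open>X\<close> only through its value at \<open>p\<close>.\<close>

definition ricci ::
  "('m::{t2_space,second_countable_topology}, 'e::euclidean_space) chart set
     \<Rightarrow> 'm connection \<Rightarrow> 'm tensor2" where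
  "ricci A D = (\<lambda>Y Z p.
     trace_on (tangent_space A p) (\<lambda>v. curvature D (extend_vector A p v) Y Z p))"


section \<open>Almost Riemann solitons\<close>

definition kulkarni_nomizu :: "'m tensor2 \<Rightarrow> 'm tensor2 \<Rightarrow> 'm tensor4" where
  "kulkarni_nomizu S T = (\<lambda>X Y Z W p.
     S X W p * T Y Z p + S Y Z p * T X W p - S X Z p * T Y W p - S Y W p * T X Z p)"

definition lie_derivative :: "'m field \<Rightarrow> 'm tensor2 \<Rightarrow> 'm tensor2" where
  "lie_derivative V T = (\<lambda>X Y p.
     V p (T X Y) - T (lie_bracket V X) Y p - T X (lie_bracket V Y) p)"

definition almost_riemann_soliton ::
  "('m::{t2_space,second_countable_topology}, 'e::euclidean_space) chart set \<Rightarrow> 'm metric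
     \<Rightarrow> 'm connection \<Rightarrow> 'm field \<Rightarrow> ('m \<Rightarrow> real) \<Rightarrow> bool" where
  "almost_riemann_soliton A g D V l \<longleftrightarrow>
     V \<in> vector_fields A \<and> (\<forall>p. V p \<noteq> 0) \<and> l \<in> smooth_functions A \<and>
     (\<forall>X\<in>vector_fields A. \<forall>Y\<in>vector_fields A. \<forall>Z\<in>vector_fields A. \<forall>W\<in>vector_fields A. \<forall>p.
        kulkarni_nomizu (\<lambda>X Y p. 1 / 2 * lie_derivative V (metric_tensor g) X Y p)
            (metric_tensor g) X Y Z W p
          + curvature_tensor g D X Y Z W p
        = l p * (1 / 2 * kulkarni_nomizu (metric_tensor g) (metric_tensor g) X Y Z W p))"

definition torse_forming ::
  "('m::{t2_space,second_countable_topology}, 'e::euclidean_space) chart set \<Rightarrow> 'm connection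
     \<Rightarrow> 'm field \<Rightarrow> ('m \<Rightarrow> real) \<Rightarrow> ('m \<Rightarrow> 'm tangent_vector \<Rightarrow> real) \<Rightarrow> bool" where
  "torse_forming A D V a \<psi> \<longleftrightarrow> a \<in> smooth_functions A \<and> one_form A \<psi> \<and>
     (\<forall>X\<in>vector_fields A. D X V = (\<lambda>p. a p *\<^sub>R X p + \<psi> p (X p) *\<^sub>R V p))"

end

theory Submission
  imports Defs
begin

text \<open>The second alternative always holds. The soliton equation and \<open>\<nabla>V = a I + \<psi> \<otimes> V\<close> give the
  curvature explicitly: with \<open>\<mu> = \<lambda> - 2 a\<close> and \<open>\<sigma>\<close> the symmetrized product of \<open>\<psi>\<close> and the dual of
  \<open>V\<close>, one has \<open>R = \<mu> G - \<sigma> \<odot> g\<close> and hence \<open>Ric = \<kappa> g - (n - 2) \<sigma>\<close>. If \<open>V\<close> and \<open>\<zeta>\<close> were linearly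
  independent at a point, then \<open>n \<ge> 3\<close> would allow a nonzero tangent vector \<open>e\<close> orthogonal to both.
  Evaluating \<open>R(V, e) \<cdot> Ric = 0\<close> on \<open>(e, V)\<close> and on \<open>(e, \<zeta>)\<close> and eliminating \<open>\<mu>\<close> yields
  \<open>(g(V,\<zeta>)\<^sup>2 - |V|\<^sup>2 |\<zeta>|\<^sup>2)\<^sup>2 = 0\<close>, the equality case of the Cauchy-Schwarz inequality, a contradiction.
  So \<open>g(V, \<zeta>) = \<plusminus>|V| |\<zeta>|\<close> everywhere, while \<open>V(|V|\<^sup>2) = 2 (a + g(V, \<zeta>)) |V|\<^sup>2\<close>.

  Tangent vectors are derivations of the global smooth functions, so the trace defining \<open>Ric\<close> needs
  that the tangent spaces have dimension \<open>n\<close> and that tangent vectors extend to vector fields; both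
  follow from bump functions and Hadamard's lemma.\<close>

section \<open>Calculus of smooth functions and bump functions\<close>

lemma Ck_on_cong:
  assumes "open S" "Ck_on k S f" "\<And>x. x \<in> S \<Longrightarrow> f x = h x"
  shows "Ck_on k S h"
  using assms(2,3)
proof (induction k arbitrary: f h)
  case 0
  then show ?case by (simp cong: continuous_on_cong)
next
  case (Suc k)
  have d: "f differentiable (at x)" if "x \<in> S" for x
    using Suc.prems that by simp
  have eq: "frechet_derivative f (at x) = frechet_derivative h (at x)" if "x \<in> S" for x
    using frechet_derivative_transform_within_open[OF d assms(1)] Suc.prems that by simp
  have "h differentiable (at x)" if "x \<in> S" for x
    using has_derivative_transform_within_open[of f _ x UNIV S h] d[OF that] assms(1) Suc.prems that
    unfolding differentiable_def by fastforce
  moreover have "Ck_on k S (\<lambda>x. frechet_derivative h (at x) v)" for v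
    by (rule Suc.IH[where f = "\<lambda>x. frechet_derivative f (at x) v"]) (use Suc.prems eq in auto)
  ultimately show ?case by simp
qed

text \<open>An explicitly known derivative may stand in for the choice-defined
  \<open>frechet_derivative\<close>; the sum, product and chain rules below run their inductions on
  k through this rule.\<close>

lemma Ck_on_SucI:
  assumes "open S" "\<And>x. x \<in> S \<Longrightarrow> (f has_derivative f' x) (at x)" "\<And>v. Ck_on k S (\<lambda>x. f' x v)"
  shows "Ck_on (Suc k) S f"
proof -
  have "f' x = frechet_derivative f (at x)" if "x \<in> S" for x
    using frechet_derivative_at assms(2) that by blast
  then have "Ck_on k S (\<lambda>x. frechet_derivative f (at x) v)" for v
    using Ck_on_cong[OF assms(1) assms(3)] by simp
  then show ?thesis using assms(2) by (auto simp: differentiable_def)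
qed

lemma Ck_on_Suc_has_derivative:
  "Ck_on (Suc k) S f \<Longrightarrow> x \<in> S \<Longrightarrow> (f has_derivative frechet_derivative f (at x)) (at x)"
  by (simp add: frechet_derivative_works)

lemma Ck_on_Suc_imp: "Ck_on (Suc k) S f \<Longrightarrow> Ck_on k S f"
proof (induction k arbitrary: f)
  case 0
  then show ?case
    by (auto intro!: continuous_at_imp_continuous_on differentiable_imp_continuous_within)
next
  case (Suc k)
  then show ?case by (metis Ck_on.simps(2))
qed

lemma Ck_on_subset: "Ck_on k S f \<Longrightarrow> T \<subseteq> S \<Longrightarrow> Ck_on k T f"
  by (induction k arbitrary: f) (auto intro: continuous_on_subset)

lemma Ck_on_Un: "open S \<Longrightarrow> open T \<Longrightarrow> Ck_on k S f \<Longrightarrow> Ck_on k T f \<Longrightarrow> Ck_on k (S \<union> T) f"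
  by (induction k arbitrary: f) (auto intro: continuous_on_open_Un)

lemma Ck_on_const: "open S \<Longrightarrow> Ck_on k S (\<lambda>x. c)"
  by (induction k arbitrary: c) auto

lemma Ck_on_bounded_linear:
  assumes "bounded_linear L" "open S" "Ck_on k S f"
  shows "Ck_on k S (\<lambda>x. L (f x))"
  using assms(3)
proof (induction k arbitrary: f)
  case 0
  then show ?case using bounded_linear.continuous_on[OF assms(1)] by simp
next
  case (Suc k)
  show ?case
    by (rule Ck_on_SucI[OF assms(2) bounded_linear.has_derivative[OF assms(1) Ck_on_Suc_has_derivative[OF Suc.prems]]])
      (use Suc in auto)
qed

lemma Ck_on_ident: "open S \<Longrightarrow> Ck_on k S (\<lambda>x. x)"
  by (cases k) (auto simp: Ck_on_const)

lemma Ck_on_add: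
  assumes "open S" "Ck_on k S f" "Ck_on k S h"
  shows "Ck_on k S (\<lambda>x. f x + h x)"
  using assms(2,3)
proof (induction k arbitrary: f h)
  case 0
  then show ?case by (auto intro: continuous_intros)
next
  case (Suc k)
  show ?case
    by (rule Ck_on_SucI[OF assms(1) has_derivative_add[OF Suc.prems[THEN Ck_on_Suc_has_derivative]]])
      (use Suc in auto)
qed

lemma Ck_on_scaleR:
  fixes f :: "_ \<Rightarrow> real"
  assumes "open S" "Ck_on k S f" "Ck_on k S h"
  shows "Ck_on k S (\<lambda>x. f x *\<^sub>R h x)"
  using assms(2,3)
proof (induction k arbitrary: f h)
  case 0
  then show ?case by (auto intro: continuous_intros)
next
  case (Suc k)
  show ?case
  proof (rule Ck_on_SucI[OF assms(1) has_derivative_scaleR[OF Suc.prems[THEN Ck_on_Suc_has_derivative]]])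
    fix v
    show "Ck_on k S (\<lambda>x. f x *\<^sub>R frechet_derivative h (at x) v + frechet_derivative f (at x) v *\<^sub>R h x)"
      by (intro Ck_on_add[OF assms(1)] Suc.IH Suc.prems[THEN Ck_on_Suc_imp]) (use Suc.prems in auto)
  qed
qed

lemma Ck_on_sum:
  assumes "open S" "\<And>i. i \<in> I \<Longrightarrow> Ck_on k S (f i)"
  shows "Ck_on k S (\<lambda>x. \<Sum>i\<in>I. f i x)"
  using assms(2)
  by (induction I rule: infinite_finite_induct) (auto intro: Ck_on_const Ck_on_add assms(1))

lemma linear_Basis_expansion:
  fixes L :: "'a::euclidean_space \<Rightarrow> 'b::real_vector"
  assumes "linear L"
  shows "L v = (\<Sum>b\<in>Basis. (v \<bullet> b) *\<^sub>R L b)"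
  by (metis (no_types, lifting) assms euclidean_representation linear_scale linear_sum sum.cong)

lemma Ck_on_compose:
  fixes f :: "'a::euclidean_space \<Rightarrow> 'b::euclidean_space"
  assumes "open S" "Ck_on k S f" "Ck_on k T h" "f ` S \<subseteq> T"
  shows "Ck_on k S (\<lambda>x. h (f x))"
  using assms(2,3)
proof (induction k arbitrary: h)
  case 0
  then show ?case using assms(4) by (auto intro: continuous_on_compose2)
next
  case (Suc k)
  have f: "(f has_derivative frechet_derivative f (at x)) (at x)" if "x \<in> S" for x
    using Ck_on_Suc_has_derivative Suc.prems that by blast
  have h: "(h has_derivative frechet_derivative h (at (f x))) (at (f x))" if "x \<in> S" for x
    using Ck_on_Suc_has_derivative Suc.prems that assms(4) by blast
  show ?case
  proof (rule Ck_on_SucI[OF assms(1) has_derivative_compose[OF f h]])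
    fix v
    \<comment> \<open>The derivative of \<open>h\<close> is applied to a direction that itself
      depends on x. Expanding that direction in \<open>Basis\<close> leaves derivatives in fixed
      directions only, and these are what \<open>Ck_on\<close> controls.\<close>
    have "Ck_on k S (\<lambda>x. \<Sum>b\<in>Basis. (frechet_derivative f (at x) v \<bullet> b) *\<^sub>R frechet_derivative h (at (f x)) b)"
    proof (intro Ck_on_sum Ck_on_scaleR Ck_on_bounded_linear[OF bounded_linear_inner_left] assms(1))
      fix b :: 'b
      show "Ck_on k S (\<lambda>x. frechet_derivative f (at x) v)" using Suc.prems by simp
      show "Ck_on k S (\<lambda>x. frechet_derivative h (at (f x)) b)"
        by (rule Suc.IH) (use Suc.prems Ck_on_Suc_imp in auto)
    qed
    then show "Ck_on k S (\<lambda>x. frechet_derivative h (at (f x)) (frechet_derivative f (at x) v))"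
      by (rule Ck_on_cong[OF assms(1)])
        (metis linear_Basis_expansion h has_derivative_linear)
  qed auto
qed

section \<open>Closure properties of smooth maps\<close>

lemma smooth_on_cong: "open S \<Longrightarrow> smooth_on S f \<Longrightarrow> (\<And>x. x \<in> S \<Longrightarrow> f x = h x) \<Longrightarrow> smooth_on S h"
  unfolding smooth_on_def using Ck_on_cong by blast

lemma smooth_on_subset: "smooth_on S f \<Longrightarrow> T \<subseteq> S \<Longrightarrow> smooth_on T f"
  unfolding smooth_on_def using Ck_on_subset by blast

lemma smooth_on_Un: "open S \<Longrightarrow> open T \<Longrightarrow> smooth_on S f \<Longrightarrow> smooth_on T f \<Longrightarrow> smooth_on (S \<union> T) f"
  unfolding smooth_on_def using Ck_on_Un by blast

lemma smooth_on_const: "open S \<Longrightarrow> smooth_on S (\<lambda>x. c)"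
  by (simp add: smooth_on_def Ck_on_const)

lemma smooth_on_add: "open S \<Longrightarrow> smooth_on S f \<Longrightarrow> smooth_on S h \<Longrightarrow> smooth_on S (\<lambda>x. f x + h x)"
  by (simp add: smooth_on_def Ck_on_add)

lemma smooth_on_mult:
  "open S \<Longrightarrow> smooth_on S f \<Longrightarrow> smooth_on S h \<Longrightarrow> smooth_on S (\<lambda>x. f x * h x :: real)"
  using Ck_on_scaleR[of S _ f h] by (simp add: smooth_on_def)

lemma smooth_on_compose:
  fixes f :: "'a::euclidean_space \<Rightarrow> 'b::euclidean_space"
  shows "open S \<Longrightarrow> smooth_on S f \<Longrightarrow> smooth_on T h \<Longrightarrow> f ` S \<subseteq> T \<Longrightarrow> smooth_on S (\<lambda>x. h (f x))"
  unfolding smooth_on_def using Ck_on_compose by blast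

lemma smooth_on_bounded_linear: "bounded_linear L \<Longrightarrow> open S \<Longrightarrow> smooth_on S L"
  unfolding smooth_on_def using Ck_on_bounded_linear Ck_on_ident by blast

lemma smooth_on_has_derivative:
  "smooth_on S f \<Longrightarrow> x \<in> S \<Longrightarrow> (f has_derivative frechet_derivative f (at x)) (at x)"
  unfolding smooth_on_def using Ck_on_Suc_has_derivative by blast

lemma smooth_on_frechet_derivative:
  "smooth_on S f \<Longrightarrow> smooth_on S (\<lambda>x. frechet_derivative f (at x) v)"
  unfolding smooth_on_def by (metis Ck_on.simps(2))

lemma smooth_on_imp_continuous_on: "smooth_on S f \<Longrightarrow> continuous_on S f"
  unfolding smooth_on_def by (metis Ck_on.simps(1))

text \<open>The open sets S and the complement of K cover the space, and f vanishes on the second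
  one.\<close>

lemma smooth_on_extend_zero:
  assumes "open S" "smooth_on S f" "closed K" "K \<subseteq> S" "\<And>x. x \<notin> K \<Longrightarrow> f x = 0"
  shows "smooth_on UNIV f"
proof -
  have "smooth_on (- K) f"
    by (rule smooth_on_cong[OF _ smooth_on_const]) (use assms in auto)
  then have "smooth_on (S \<union> - K) f"
    using smooth_on_Un[OF assms(1) open_Compl[OF assms(3)] assms(2)] by blast
  moreover have "S \<union> - K = UNIV" using assms by auto
  ultimately show ?thesis by simp
qed

section \<open>The flat exponential and bump functions\<close>

definition cutoff_exp :: "nat \<Rightarrow> real \<Rightarrow> real" where
  "cutoff_exp n x = (if x > 0 then exp (- 1 / x) / x ^ n else 0)"

text \<open>For x > 0 the substitution y = 1/x turns the function into y^n / exp y, which tends to 0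
  as y grows.\<close>

lemma cutoff_exp_tendsto_0: "(cutoff_exp n \<longlongrightarrow> 0) (at 0)"
proof -
  have "((\<lambda>y::real. y ^ n / exp y) \<longlongrightarrow> 0) at_top" by (rule tendsto_power_div_exp_0)
  then have "((\<lambda>x. inverse x ^ n / exp (inverse x)) \<longlongrightarrow> (0::real)) (at_right 0)"
    using filterlim_compose filterlim_inverse_at_top_right by blast
  moreover have "\<forall>\<^sub>F x in at_right 0. inverse x ^ n / exp (inverse x) = cutoff_exp n (x::real)"
    unfolding eventually_at_filter
    by (auto simp: cutoff_exp_def exp_minus field_simps)
  ultimately have "(cutoff_exp n \<longlongrightarrow> 0) (at_right 0)"
    by (rule Lim_transform_eventually)
  moreover have "(cutoff_exp n \<longlongrightarrow> 0) (at_left 0)"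
    by (rule tendsto_eventually) (simp add: eventually_at_filter cutoff_exp_def)
  ultimately show ?thesis by (simp add: filterlim_at_split)
qed

text \<open>The denominators \<open>x ^ n\<close> make the family closed under differentiation up to
  linear combinations, so smoothness follows by an induction over the order that keeps n
  arbitrary.\<close>

lemma cutoff_exp_has_derivative:
  "(cutoff_exp n has_real_derivative (cutoff_exp (n + 2) x - n * cutoff_exp (n + 1) x)) (at x)"
proof -
  consider "x > 0" | "x < 0" | "x = 0" by linarith
  then show ?thesis
  proof cases
    case 1
    have "((\<lambda>x. exp (- 1 / x) / x ^ n) has_real_derivative
        (cutoff_exp (n + 2) x - n * cutoff_exp (n + 1) x)) (at x)"
    proof (cases n)
      case 0
      then show ?thesis using 1
        by (auto intro!: derivative_eq_intros simp: cutoff_exp_def field_simps power2_eq_square)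
    next
      case (Suc m)
      then show ?thesis using 1
        by (auto intro!: derivative_eq_intros
            simp: cutoff_exp_def field_simps power2_eq_square simp flip: power_Suc)
          (simp add: algebra_simps)
    qed
    then show ?thesis
      by (rule has_field_derivative_transform_within_open[where S = "{0<..}"])
        (use 1 in \<open>auto simp: cutoff_exp_def\<close>)
  next
    case 2
    have "((\<lambda>x. 0) has_real_derivative (cutoff_exp (n + 2) x - n * cutoff_exp (n + 1) x)) (at x)"
      using 2 by (auto simp: cutoff_exp_def)
    then show ?thesis
      by (rule has_field_derivative_transform_within_open[where S = "{..<0}"])
        (use 2 in \<open>auto simp: cutoff_exp_def\<close>)
  next
    case 3
    \<comment> \<open>Dividing by h raises the exponent of the denominator by one, so the difference
      quotient at 0 is again a member of the family and has limit 0.\<close>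
    have "(\<lambda>h. (cutoff_exp n (0 + h) - cutoff_exp n 0) / h) = cutoff_exp (Suc n)"
      by (auto simp: cutoff_exp_def fun_eq_iff)
    then have "(cutoff_exp n has_real_derivative 0) (at 0)"
      unfolding DERIV_def using cutoff_exp_tendsto_0[of "Suc n"] by simp
    moreover have "cutoff_exp (n + 2) x - n * cutoff_exp (n + 1) x = 0"
      using 3 by (simp add: cutoff_exp_def)
    ultimately show ?thesis using 3 by simp
  qed
qed

lemma smooth_on_cutoff_exp: "smooth_on UNIV (cutoff_exp n)"
  unfolding smooth_on_def
proof
  fix k
  show "Ck_on k UNIV (cutoff_exp n)"
  proof (induction k arbitrary: n)
    case 0
    have "isCont (cutoff_exp n) x" for x
      using cutoff_exp_has_derivative DERIV_isCont by blast
    then show ?case by (simp add: continuous_at_imp_continuous_on)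
  next
    case (Suc k)
    show ?case
    proof (rule Ck_on_SucI)
      fix x show "(cutoff_exp n has_derivative
          (\<lambda>v. (cutoff_exp (n + 2) x - n * cutoff_exp (n + 1) x) * v)) (at x)"
        using cutoff_exp_has_derivative[of n x] by (simp add: has_field_derivative_def)
    next
      fix v
      have "Ck_on k UNIV (\<lambda>x. v *\<^sub>R (cutoff_exp (n + 2) x + (- real n) *\<^sub>R cutoff_exp (n + 1) x))"
        by (intro Ck_on_scaleR Ck_on_add Ck_on_const Suc.IH open_UNIV)
      then show "Ck_on k UNIV (\<lambda>x. (cutoff_exp (n + 2) x - n * cutoff_exp (n + 1) x) * v)"
        by (simp add: mult.commute)
    qed simp
  qed
qed

lemma bump_exists:
  fixes x0 :: "'a::euclidean_space"
  assumes "r > 0"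
  shows "\<exists>b :: 'a \<Rightarrow> real. smooth_on UNIV b \<and> b x0 > 0 \<and> (\<forall>x. x \<notin> cball x0 r \<longrightarrow> b x = 0)"
proof -
  \<comment> \<open>The argument is r^2 - |x - x0|^2, positive exactly on the open ball. The squared
    norm is spelled out in coordinates so that the closure rules for sums and products
    apply.\<close>
  define b where "b = (\<lambda>x. cutoff_exp 0 (r\<^sup>2 + (- 1) *\<^sub>R (\<Sum>i\<in>Basis. ((x - x0) \<bullet> i) *\<^sub>R ((x - x0) \<bullet> i))))"
  have "smooth_on UNIV (\<lambda>x. r\<^sup>2 + (- 1) *\<^sub>R (\<Sum>i\<in>Basis. ((x - x0) \<bullet> i) *\<^sub>R ((x - x0) \<bullet> i)))"
    unfolding smooth_on_def diff_conv_add_uminus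
    by (intro allI Ck_on_add Ck_on_const Ck_on_scaleR Ck_on_sum Ck_on_ident open_UNIV
        Ck_on_bounded_linear[OF bounded_linear_inner_left])
  then have "smooth_on UNIV b"
    unfolding b_def using smooth_on_compose[OF open_UNIV _ smooth_on_cutoff_exp] by blast
  moreover have "b x = cutoff_exp 0 (r\<^sup>2 - (dist x x0)\<^sup>2)" for x
    by (simp add: b_def dist_norm power2_norm_eq_inner flip: euclidean_inner)
  ultimately show ?thesis
    using assms by (intro exI[of _ b]) (auto simp: cutoff_exp_def not_le dist_commute dest!: power2_less_imp_less intro!: power_mono)
qed

section \<open>Hadamard's lemma\<close>

lemma segment_in_ball:
  fixes x0 :: "'a::real_normed_vector"
  assumes "x \<in> ball x0 R" "t \<in> {0..1::real}"
  shows "x0 + t *\<^sub>R (x - x0) \<in> ball x0 R"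
proof -
  have "t * norm (x - x0) \<le> norm (x - x0)"
    using assms(2) by (intro mult_left_le_one_le) auto
  then show ?thesis
    using assms by (simp add: dist_norm norm_minus_commute)
qed

text \<open>Joint continuity in x and t is what both the continuity of a parameter integral and
  differentiation under the integral sign require.\<close>

lemma continuous_on_radial:
  fixes u :: "'a::real_normed_vector \<Rightarrow> 'b::real_normed_vector"
  assumes "continuous_on (ball x0 R) u"
  shows "continuous_on (ball x0 R \<times> cbox 0 1) (\<lambda>(x, t::real). t ^ m *\<^sub>R u (x0 + t *\<^sub>R (x - x0)))"
  unfolding split_def
  by (intro continuous_intros continuous_on_compose2[OF assms])
    (auto intro!: segment_in_ball simp del: mem_ball)

lemma radial_integrable:
  fixes u :: "'a::real_normed_vector \<Rightarrow> 'b::banach"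
  assumes "continuous_on (ball x0 R) u" "x \<in> ball x0 R"
  shows "(\<lambda>t::real. t ^ m *\<^sub>R u (x0 + t *\<^sub>R (x - x0))) integrable_on cbox 0 1"
  by (intro integrable_continuous continuous_intros continuous_on_compose2[OF assms(1)])
    (use assms(2) in \<open>auto intro!: segment_in_ball simp del: mem_ball\<close>)

text \<open>Differentiating under the integral sign turns \<open>(m, u)\<close> into \<open>(Suc m, \<partial>\<^sub>v u)\<close>; the weight
  \<open>t ^ m\<close> makes the statement inductive.\<close>

lemma Ck_on_radial_integral:
  fixes u :: "'a::euclidean_space \<Rightarrow> real"
  assumes "smooth_on (ball x0 R) u"
  shows "Ck_on k (ball x0 R) (\<lambda>x. integral (cbox 0 1) (\<lambda>t::real. t ^ m *\<^sub>R u (x0 + t *\<^sub>R (x - x0))))"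
  using assms
proof (induction k arbitrary: u m)
  case 0
  then show ?case
    using integral_continuous_on_param[OF continuous_on_radial[OF smooth_on_imp_continuous_on]]
    unfolding Ck_on.simps by blast
next
  case (Suc k)
  \<comment> \<open>The Leibniz rule integrates the derivative as an element of a Banach space, so
    it is packed into a bounded linear operator.\<close>
  define Du where "Du = (\<lambda>y. Blinfun (frechet_derivative u (at y)))"
  have Du: "blinfun_apply (Du y) = frechet_derivative u (at y)" if "y \<in> ball x0 R" for y
    unfolding Du_def
    by (rule bounded_linear_Blinfun_apply)
      (use smooth_on_has_derivative[OF Suc.prems that] has_derivative_bounded_linear in blast)
  have contD: "continuous_on (ball x0 R) Du"
  proof (rule continuous_on_blinfun_componentwise)
    fix i :: 'a
    have "continuous_on (ball x0 R) (\<lambda>x. frechet_derivative u (at x) i)"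
      using smooth_on_frechet_derivative[OF Suc.prems] smooth_on_imp_continuous_on by blast
    then show "continuous_on (ball x0 R) (\<lambda>x. blinfun_apply (Du x) i)"
      by (rule continuous_on_eq) (simp add: Du)
  qed
  \<comment> \<open>The exponent rises to \<open>Suc m\<close> because the inner map has derivative
    v to t v.\<close>
  define F where "F = (\<lambda>x (t::real). t ^ Suc m *\<^sub>R Du (x0 + t *\<^sub>R (x - x0)))"
  have der: "((\<lambda>x. t ^ m *\<^sub>R u (x0 + t *\<^sub>R (x - x0))) has_derivative blinfun_apply (F x t))
      (at x within ball x0 R)" if x: "x \<in> ball x0 R" and t: "t \<in> cbox 0 1" for x t
  proof -
    have y: "x0 + t *\<^sub>R (x - x0) \<in> ball x0 R" using segment_in_ball x t by auto
    have "((\<lambda>x. x0 + t *\<^sub>R (x - x0)) has_derivative (\<lambda>v. t *\<^sub>R v)) (at x within ball x0 R)"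
      by (auto intro!: derivative_eq_intros)
    from has_derivative_scaleR_right[OF has_derivative_compose[OF this smooth_on_has_derivative[OF Suc.prems y]], of "t ^ m"]
    have "((\<lambda>x. t ^ m *\<^sub>R u (x0 + t *\<^sub>R (x - x0))) has_derivative
        (\<lambda>v. t ^ m *\<^sub>R blinfun_apply (Du (x0 + t *\<^sub>R (x - x0))) (t *\<^sub>R v))) (at x within ball x0 R)"
      unfolding Du[OF y] .
    moreover have "(\<lambda>v. t ^ m *\<^sub>R blinfun_apply (Du (x0 + t *\<^sub>R (x - x0))) (t *\<^sub>R v)) = blinfun_apply (F x t)"
      by (simp add: F_def blinfun.scaleR_left blinfun.scaleR_right mult_ac fun_eq_iff)
    ultimately show ?thesis by simp
  qed
  have intF: "F x integrable_on cbox 0 1" if "x \<in> ball x0 R" for x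
    unfolding F_def by (rule radial_integrable[OF contD that])
  have deriv: "((\<lambda>x. integral (cbox 0 1) (\<lambda>t::real. t ^ m *\<^sub>R u (x0 + t *\<^sub>R (x - x0))))
      has_derivative blinfun_apply (integral (cbox 0 1) (F x))) (at x)" if x: "x \<in> ball x0 R" for x
  proof -
    have "((\<lambda>x. integral (cbox 0 1) (\<lambda>t::real. t ^ m *\<^sub>R u (x0 + t *\<^sub>R (x - x0))))
      has_derivative blinfun_apply (integral (cbox 0 1) (F x))) (at x within ball x0 R)"
    proof (rule leibniz_rule[OF der])
      show "continuous_on (ball x0 R \<times> cbox 0 1) (\<lambda>(x, t). F x t)"
        unfolding F_def by (rule continuous_on_radial[OF contD])
    qed (use x radial_integrable[OF smooth_on_imp_continuous_on[OF Suc.prems]] in auto)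
    then show ?thesis using x by (simp add: at_within_open[OF _ open_ball])
  qed
  show ?case
  proof (rule Ck_on_SucI[OF open_ball deriv])
    fix v
    have "Ck_on k (ball x0 R) (\<lambda>x. integral (cbox 0 1)
        (\<lambda>t::real. t ^ Suc m *\<^sub>R frechet_derivative u (at (x0 + t *\<^sub>R (x - x0))) v))"
      by (rule Suc.IH[OF smooth_on_frechet_derivative[OF Suc.prems]])
    then show "Ck_on k (ball x0 R) (\<lambda>x. blinfun_apply (integral (cbox 0 1) (F x)) v)"
    proof (rule Ck_on_cong[OF open_ball])
      fix x assume x: "x \<in> ball x0 R"
      have "integral (cbox 0 1) (\<lambda>t. blinfun_apply (F x t) v) = blinfun_apply (integral (cbox 0 1) (F x)) v"
        using blinfun_apply_integral[OF intF[OF x]] by simp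
      moreover have "integral (cbox 0 1) (\<lambda>t. blinfun_apply (F x t) v) = integral (cbox 0 1)
          (\<lambda>t::real. t ^ Suc m *\<^sub>R frechet_derivative u (at (x0 + t *\<^sub>R (x - x0))) v)"
        by (rule integral_cong)
          (simp add: F_def Du[OF segment_in_ball[OF x]] blinfun.scaleR_left del: mem_ball)
      ultimately show "integral (cbox 0 1)
          (\<lambda>t::real. t ^ Suc m *\<^sub>R frechet_derivative u (at (x0 + t *\<^sub>R (x - x0))) v)
          = blinfun_apply (integral (cbox 0 1) (F x)) v"
        by simp
    qed
  qed
qed

text \<open>The fundamental theorem of calculus along the segment from x0 to x writes f x - f x0 as
  the integral of a directional derivative. Expanding the direction in \<open>Basis\<close> gives G
  as the integrals of the partial derivatives.\<close>

lemma hadamard: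
  fixes f :: "'a::euclidean_space \<Rightarrow> real"
  assumes "smooth_on (ball x0 R) f" "R > 0"
  shows "\<exists>G. (\<forall>b. smooth_on (ball x0 R) (G b) \<and> G b x0 = frechet_derivative f (at x0) b) \<and>
    (\<forall>x\<in>ball x0 R. f x = f x0 + (\<Sum>b\<in>Basis. ((x - x0) \<bullet> b) * G b x))"
proof -
  define D where "D = (\<lambda>b x. frechet_derivative f (at x) b)"
  \<comment> \<open>The factor \<open>t ^ 0\<close> keeps the integrand in the shape of
    \<open>Ck_on_radial_integral\<close> with m = 0.\<close>
  define G where "G = (\<lambda>b x. integral (cbox 0 1) (\<lambda>t::real. t ^ 0 *\<^sub>R D b (x0 + t *\<^sub>R (x - x0))))"
  have smD: "smooth_on (ball x0 R) (D b)" for b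
    unfolding D_def by (rule smooth_on_frechet_derivative[OF assms(1)])
  have "smooth_on (ball x0 R) (G b)" for b
    unfolding G_def smooth_on_def using Ck_on_radial_integral[OF smD] by blast
  moreover have "G b x0 = frechet_derivative f (at x0) b" for b
    by (simp add: G_def D_def)
  moreover have "f x = f x0 + (\<Sum>b\<in>Basis. ((x - x0) \<bullet> b) * G b x)" if x: "x \<in> ball x0 R" for x
  proof -
    let ?y = "\<lambda>t. x0 + t *\<^sub>R (x - x0)"
    let ?S = "\<lambda>t. \<Sum>b\<in>Basis. ((x - x0) \<bullet> b) * (t ^ 0 *\<^sub>R D b (?y t))"
    have "(?S has_integral f (?y 1) - f (?y 0)) {0..1}"
    proof (rule fundamental_theorem_of_calculus)
      fix t :: real assume t: "t \<in> {0..1}"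
      have f: "(f has_derivative frechet_derivative f (at (?y t))) (at (?y t))"
        using smooth_on_has_derivative[OF assms(1) segment_in_ball[OF x t]] .
      have "(?y has_derivative (\<lambda>s. s *\<^sub>R (x - x0))) (at t within {0..1})"
        by (auto intro!: derivative_eq_intros)
      from has_derivative_compose[OF this f]
      have "((\<lambda>t. f (?y t)) has_derivative (\<lambda>s. frechet_derivative f (at (?y t)) (s *\<^sub>R (x - x0))))
          (at t within {0..1})" .
      moreover have "frechet_derivative f (at (?y t)) (s *\<^sub>R (x - x0)) = s *\<^sub>R ?S t" for s
        using linear_Basis_expansion[OF has_derivative_linear[OF f], of "x - x0"]
          linear_scale[OF has_derivative_linear[OF f]] by (simp add: D_def)
      ultimately show "((\<lambda>t. f (?y t)) has_vector_derivative ?S t) (at t within {0..1})"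
        by (simp add: has_vector_derivative_def)
    qed simp
    moreover have "(?S has_integral (\<Sum>b\<in>Basis. ((x - x0) \<bullet> b) * G b x)) (cbox 0 1)"
      unfolding G_def
      by (intro has_integral_sum has_integral_mult_right integrable_integral finite_Basis
          radial_integrable[OF smooth_on_imp_continuous_on[OF smD] x])
    ultimately have "f (?y 1) - f (?y 0) = (\<Sum>b\<in>Basis. ((x - x0) \<bullet> b) * G b x)"
      unfolding interval_cbox by (rule has_integral_unique)
    then show ?thesis by simp
  qed
  ultimately show ?thesis by blast
qed

section \<open>Tangent spaces of a smooth manifold\<close>

lemma sum_fun_apply: "(\<Sum>i\<in>I. F i) x = (\<Sum>i\<in>I. F i x)"
  by (induction I rule: infinite_finite_induct) auto

lemma smooth_atlas_chart:
  assumes "smooth_atlas A" "(U, \<phi>) \<in> A"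
  shows "open U" "open (\<phi> ` U)" "\<exists>\<phi>'. homeomorphism U (\<phi> ` U) \<phi> \<phi>'" "inj_on \<phi> U"
proof -
  have *: "open U \<and> open (\<phi> ` U) \<and> (\<exists>\<phi>'. homeomorphism U (\<phi> ` U) \<phi> \<phi>')"
    using assms unfolding smooth_atlas_def by blast
  then show "open U" "open (\<phi> ` U)" "\<exists>\<phi>'. homeomorphism U (\<phi> ` U) \<phi> \<phi>'" by auto
  then show "inj_on \<phi> U" by (metis homeomorphism_apply1 inj_on_inverseI)
qed

lemma smooth_atlas_transition:
  "smooth_atlas A \<Longrightarrow> (U, \<phi>) \<in> A \<Longrightarrow> (W, \<theta>) \<in> A \<Longrightarrow> smooth_on (\<phi> ` (U \<inter> W)) (\<theta> \<circ> inv_into U \<phi>)"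
  unfolding smooth_atlas_def by fast

lemma chart_image_open:
  assumes "smooth_atlas A" "(U, \<phi>) \<in> A" "open N" "N \<subseteq> U"
  shows "open (\<phi> ` N)"
proof -
  obtain \<phi>' where "homeomorphism U (\<phi> ` U) \<phi> \<phi>'"
    using smooth_atlas_chart[OF assms(1,2)] by blast
  moreover have "openin (top_of_set U) N" using assms by (auto simp: openin_open)
  ultimately have "openin (top_of_set (\<phi> ` U)) (\<phi> ` N)" by (rule homeomorphism_imp_open_map)
  then show ?thesis using smooth_atlas_chart(2)[OF assms(1,2)] openin_open_trans by blast
qed

lemma smooth_functionsD:
  "f \<in> smooth_functions A \<Longrightarrow> (U, \<phi>) \<in> A \<Longrightarrow> smooth_on (\<phi> ` U) (\<lambda>x. f (inv_into U \<phi> x))"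
  unfolding smooth_functions_def by (auto simp: o_def)

lemma smooth_functionsI:
  "(\<And>U \<phi>. (U, \<phi>) \<in> A \<Longrightarrow> smooth_on (\<phi> ` U) (\<lambda>x. f (inv_into U \<phi> x))) \<Longrightarrow> f \<in> smooth_functions A"
  unfolding smooth_functions_def by (auto simp: o_def)

lemma smooth_functions_const: "smooth_atlas A \<Longrightarrow> (\<lambda>q. c) \<in> smooth_functions A"
  by (rule smooth_functionsI, rule smooth_on_const, rule smooth_atlas_chart)

lemma smooth_functions_add:
  "smooth_atlas A \<Longrightarrow> f \<in> smooth_functions A \<Longrightarrow> h \<in> smooth_functions A \<Longrightarrow>
    (\<lambda>q. f q + h q) \<in> smooth_functions A"
  by (rule smooth_functionsI, rule smooth_on_add) (auto intro: smooth_atlas_chart smooth_functionsD)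

lemma smooth_functions_mult:
  "smooth_atlas A \<Longrightarrow> f \<in> smooth_functions A \<Longrightarrow> h \<in> smooth_functions A \<Longrightarrow>
    (\<lambda>q. f q * h q) \<in> smooth_functions A"
  by (rule smooth_functionsI, rule smooth_on_mult) (auto intro: smooth_atlas_chart smooth_functionsD)

lemma smooth_functions_sum:
  "smooth_atlas A \<Longrightarrow> (\<And>i. i \<in> I \<Longrightarrow> f i \<in> smooth_functions A) \<Longrightarrow>
    (\<lambda>q. \<Sum>i\<in>I. f i q) \<in> smooth_functions A"
  by (induction I rule: infinite_finite_induct)
    (auto intro: smooth_functions_const smooth_functions_add)

definition chart_extend :: "'m set \<Rightarrow> ('m \<Rightarrow> 'e) \<Rightarrow> ('e \<Rightarrow> real) \<Rightarrow> 'm \<Rightarrow> real" where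
  "chart_extend U \<phi> u q = (if q \<in> U then u (\<phi> q) else 0)"

text \<open>The part K of U lying over the ball is compact, hence closed in the Hausdorff space. Any
  chart domain W is then the union of the open sets W \<inter> U, where the transition map is
  smooth, and W - K, where the function is zero.\<close>

lemma smooth_functions_chart_extend:
  fixes A :: "('m::{t2_space,second_countable_topology}, 'e::euclidean_space) chart set"
  assumes A: "smooth_atlas A" "(U, \<phi>) \<in> A"
    and u: "smooth_on (\<phi> ` U) u" "cball x0 r \<subseteq> \<phi> ` U" "\<And>x. x \<notin> cball x0 r \<Longrightarrow> u x = 0"
  shows "chart_extend U \<phi> u \<in> smooth_functions A"
proof (rule smooth_functionsI)
  fix W \<theta> assume W: "(W, \<theta>) \<in> A"
  obtain \<phi>' where hom: "homeomorphism U (\<phi> ` U) \<phi> \<phi>'"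
    using smooth_atlas_chart[OF A] by blast
  define K where "K = \<phi>' ` cball x0 r"
  have "compact K"
    unfolding K_def using hom u(2)
    by (intro compact_continuous_image) (auto simp: homeomorphism_def intro: continuous_on_subset)
  then have "closed K" by (rule compact_imp_closed)
  have K: "\<phi> q \<notin> cball x0 r" if "q \<in> U" "q \<notin> K" for q
    using that homeomorphism_apply1[OF hom, of q] by (auto simp: K_def image_iff simp del: mem_cball)
  have W': "open W" "inj_on \<theta> W" using smooth_atlas_chart[OF A(1) W] by auto
  have inv: "inv_into W \<theta> (\<theta> q) = q" if "q \<in> W" for q
    using that W' by simp
  let ?f = "\<lambda>x. chart_extend U \<phi> u (inv_into W \<theta> x)"
  have o1: "open (\<theta> ` (W \<inter> U))"
    by (rule chart_image_open[OF A(1) W open_Int[OF W'(1) smooth_atlas_chart(1)[OF A]]]) blast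
  have o2: "open (\<theta> ` (W - K))"
    by (rule chart_image_open[OF A(1) W open_Diff[OF W'(1) \<open>closed K\<close>]]) blast
  have "smooth_on (\<theta> ` (W \<inter> U)) (\<lambda>x. u ((\<phi> \<circ> inv_into W \<theta>) x))"
    by (rule smooth_on_compose[OF o1 smooth_atlas_transition[OF A(1) W A(2)] u(1)])
      (auto simp: inv)
  then have 1: "smooth_on (\<theta> ` (W \<inter> U)) ?f"
    by (rule smooth_on_cong[OF o1]) (auto simp: inv chart_extend_def)
  have 2: "smooth_on (\<theta> ` (W - K)) ?f"
    by (rule smooth_on_cong[OF o2 smooth_on_const[OF o2, of 0]])
      (use K u(3) in \<open>auto simp: inv chart_extend_def\<close>)
  have "K \<subseteq> U" using hom u(2) by (auto simp: K_def homeomorphism_def)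
  then have "\<theta> ` W = \<theta> ` (W \<inter> U) \<union> \<theta> ` (W - K)" by auto
  then show "smooth_on (\<theta> ` W) ?f"
    using smooth_on_Un[OF o1 o2 1 2] by simp
qed

section \<open>Derivations at a point and vector fields\<close>

lemma subspace_tangent_space: "subspace (tangent_space A p)"
  by (rule subspaceI) (auto simp: tangent_space_def scaleR_fun_def algebra_simps)

lemma tangent_space_add:
  "v \<in> tangent_space A p \<Longrightarrow> f \<in> smooth_functions A \<Longrightarrow> h \<in> smooth_functions A \<Longrightarrow>
    v (\<lambda>q. f q + h q) = v f + v h"
  unfolding tangent_space_def by blast

lemma tangent_space_mult:
  "v \<in> tangent_space A p \<Longrightarrow> f \<in> smooth_functions A \<Longrightarrow> h \<in> smooth_functions A \<Longrightarrow>
    v (\<lambda>q. f q * h q) = f p * v h + h p * v f"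
  unfolding tangent_space_def by blast

lemma tangent_space_cmult:
  "v \<in> tangent_space A p \<Longrightarrow> f \<in> smooth_functions A \<Longrightarrow> v (\<lambda>q. c * f q) = c * v f"
  unfolding tangent_space_def by blast

lemma tangent_space_const:
  assumes "smooth_atlas A" "v \<in> tangent_space A p"
  shows "v (\<lambda>q. c) = 0"
proof -
  note 1 = smooth_functions_const[OF assms(1), of 1]
  \<comment> \<open>The Leibniz rule for 1 = 1 * 1 doubles the value.\<close>
  have "v (\<lambda>q. 1) = 0" using tangent_space_mult[OF assms(2) 1 1] by simp
  moreover have "v (\<lambda>q. c * 1) = c * v (\<lambda>q. 1)"
    by (rule tangent_space_cmult[OF assms(2) 1])
  ultimately show ?thesis by simp
qed

lemma tangent_space_sum:
  assumes "smooth_atlas A" "v \<in> tangent_space A p" "\<And>i. i \<in> I \<Longrightarrow> f i \<in> smooth_functions A"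
  shows "v (\<lambda>q. \<Sum>i\<in>I. f i q) = (\<Sum>i\<in>I. v (f i))"
  using assms(3)
proof (induction I rule: infinite_finite_induct)
  case (insert i I)
  then show ?case
    using tangent_space_add[OF assms(2), of "f i" "\<lambda>q. \<Sum>i\<in>I. f i q"] smooth_functions_sum[OF assms(1), of I f]
    by simp
qed (auto simp: tangent_space_const[OF assms(1,2)])

lemma subspace_vector_fields:
  assumes "smooth_atlas A"
  shows "subspace (vector_fields A)"
proof (rule subspaceI)
  show "0 \<in> vector_fields A"
    using subspace_0[OF subspace_tangent_space[of A]] smooth_functions_const[OF assms]
    by (auto simp: vector_fields_def)
  show "X + Y \<in> vector_fields A" if "X \<in> vector_fields A" "Y \<in> vector_fields A" for X Y
    using that subspace_add[OF subspace_tangent_space[of A]] smooth_functions_add[OF assms]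
    by (auto simp: vector_fields_def)
  show "c *\<^sub>R X \<in> vector_fields A" if "X \<in> vector_fields A" for c X
    using that subspace_scale[OF subspace_tangent_space[of A]]
      smooth_functions_mult[OF assms smooth_functions_const[OF assms]]
    by (auto simp: vector_fields_def scaleR_fun_def)
qed

lemma chart_ball_exists:
  fixes A :: "('m::{t2_space,second_countable_topology}, 'e::euclidean_space) chart set"
  assumes "smooth_atlas A"
  shows "\<exists>U \<phi> R. (U, \<phi>) \<in> A \<and> p \<in> U \<and> R > 0 \<and> ball (\<phi> p) R \<subseteq> \<phi> ` U"
proof -
  have "p \<in> (\<Union>(U, \<phi>)\<in>A. U)" using assms by (auto simp: smooth_atlas_def)
  then obtain U \<phi> where U: "(U, \<phi>) \<in> A" "p \<in> U" by auto
  then have "\<exists>R>0. ball (\<phi> p) R \<subseteq> \<phi> ` U"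
    using smooth_atlas_chart(2)[OF assms U(1)] open_contains_ball by blast
  then show ?thesis using U by blast
qed

text \<open>A partial derivative in a chart, cut off by a bump function \<open>b\<close> so as to be defined on the
  whole manifold.\<close>

definition chart_field ::
  "('m::{t2_space,second_countable_topology}, 'e::euclidean_space) chart set \<Rightarrow> 'm set \<Rightarrow> ('m \<Rightarrow> 'e)
     \<Rightarrow> ('e \<Rightarrow> real) \<Rightarrow> 'e \<Rightarrow> 'm field" where
  "chart_field A U \<phi> b w p f = (if f \<in> smooth_functions A then
     chart_extend U \<phi> (\<lambda>x. b x * frechet_derivative (\<lambda>x. f (inv_into U \<phi> x)) (at x) w) p else 0)"

text \<open>The derivation laws are those of a directional derivative in the chart. The support of
  \<open>b\<close> in a closed ball inside the chart image makes the extension by zero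
  smooth.\<close>

lemma chart_field_in_vector_fields:
  fixes A :: "('m::{t2_space,second_countable_topology}, 'e::euclidean_space) chart set"
  assumes A: "smooth_atlas A" "(U, \<phi>) \<in> A"
    and b: "smooth_on UNIV b" "cball x0 r \<subseteq> \<phi> ` U" "\<And>x. x \<notin> cball x0 r \<Longrightarrow> b x = 0"
  shows "chart_field A U \<phi> b w \<in> vector_fields A"
proof -
  let ?D = "\<lambda>f x. frechet_derivative (\<lambda>x. f (inv_into U \<phi> x)) (at x) w"
  note oU = smooth_atlas_chart(2)[OF A]
  have inv: "inv_into U \<phi> (\<phi> q) = q" if "q \<in> U" for q
    using that smooth_atlas_chart(4)[OF A] by simp
  have der: "((\<lambda>x. f (inv_into U \<phi> x)) has_derivative
      frechet_derivative (\<lambda>x. f (inv_into U \<phi> x)) (at (\<phi> q))) (at (\<phi> q))"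
    if "q \<in> U" "f \<in> smooth_functions A" for f q
    using smooth_on_has_derivative[OF smooth_functionsD[OF that(2) A(2)]] that(1) by blast
  have add: "?D (\<lambda>q. f q + h q) (\<phi> q) = ?D f (\<phi> q) + ?D h (\<phi> q)"
    and mult: "?D (\<lambda>q. f q * h q) (\<phi> q) = f q * ?D h (\<phi> q) + h q * ?D f (\<phi> q)"
    if "q \<in> U" "f \<in> smooth_functions A" "h \<in> smooth_functions A" for f h q
    using frechet_derivative_at[OF has_derivative_add[OF der[OF that(1,2)] der[OF that(1,3)]]]
      frechet_derivative_at[OF has_derivative_mult[OF der[OF that(1,2)] der[OF that(1,3)]]]
    by (simp_all add: fun_eq_iff inv[OF that(1)] mult.commute[of "h q"])
  have cmult: "?D (\<lambda>q. c * f q) (\<phi> q) = c * ?D f (\<phi> q)"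
    if "q \<in> U" "f \<in> smooth_functions A" for f q c
    using frechet_derivative_at[OF has_derivative_mult_right[OF der[OF that], of c]]
    by (simp add: fun_eq_iff)
  have "chart_field A U \<phi> b w q \<in> tangent_space A q" for q
  proof -
    let ?v = "chart_field A U \<phi> b w q"
    have v: "?v f = (if q \<in> U then b (\<phi> q) * ?D f (\<phi> q) else 0)" if "f \<in> smooth_functions A" for f
      using that by (simp add: chart_field_def chart_extend_def)
    have "?v (\<lambda>q. f q + h q) = ?v f + ?v h" "?v (\<lambda>q. f q * h q) = f q * ?v h + h q * ?v f"
      if "f \<in> smooth_functions A" "h \<in> smooth_functions A" for f h
      unfolding v[OF that(1)] v[OF that(2)] v[OF smooth_functions_add[OF A(1) that]]
        v[OF smooth_functions_mult[OF A(1) that]]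
      by (simp_all add: add[OF _ that] mult[OF _ that] distrib_left mult.left_commute)
    moreover have "?v (\<lambda>q. c * f q) = c * ?v f" if "f \<in> smooth_functions A" for c f
      unfolding v[OF that] v[OF smooth_functions_mult[OF A(1) smooth_functions_const[OF A(1)] that]]
      by (simp add: cmult[OF _ that] mult.left_commute)
    ultimately show ?thesis
      by (simp add: tangent_space_def chart_field_def)
  qed
  moreover have "(\<lambda>q. chart_field A U \<phi> b w q f) \<in> smooth_functions A" if f: "f \<in> smooth_functions A" for f
  proof -
    have "smooth_on (\<phi> ` U) (\<lambda>x. b x * ?D f x)"
      by (intro smooth_on_mult oU smooth_on_frechet_derivative smooth_functionsD[OF f A(2)]
          smooth_on_subset[OF b(1)]) auto
    then have "chart_extend U \<phi> (\<lambda>x. b x * ?D f x) \<in> smooth_functions A"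
      by (rule smooth_functions_chart_extend[OF A _ b(2)]) (simp add: b(3))
    then show ?thesis using f by (simp add: chart_field_def[abs_def])
  qed
  ultimately show ?thesis by (simp add: vector_fields_def)
qed

section \<open>Bases of tangent spaces and extension of tangent vectors\<close>

lemma independent_family:
  fixes e :: "'i \<Rightarrow> 'v::real_vector"
  assumes "finite I" "\<forall>c. (\<Sum>i\<in>I. c i *\<^sub>R e i) = 0 \<longrightarrow> (\<forall>j\<in>I. c j = 0)"
  shows "inj_on e I" "independent (e ` I)"
proof -
  show inj: "inj_on e I"
  proof (rule inj_onI, rule ccontr)
    fix i j assume ij: "i \<in> I" "j \<in> I" "e i = e j" "i \<noteq> j"
    \<comment> \<open>Two equal members give a relation with coefficients 1 and -1. Injectivity is
      recorded because the cardinality of the image has to be computed.\<close>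
    have "(\<Sum>k\<in>I. ((if k = i then 1 else 0) - (if k = j then 1 else 0)) *\<^sub>R e k) = e i - e j"
      using assms(1) ij(1,2) by (simp add: scaleR_left_diff_distrib sum_subtractf if_distrib[of "\<lambda>c. c *\<^sub>R _"] cong: if_cong)
    then have "\<forall>k\<in>I. (if k = i then 1 else 0) - (if k = j then 1 else 0) = (0::real)"
      using ij(3) spec[OF assms(2), of "\<lambda>k. (if k = i then 1 else 0) - (if k = j then 1 else 0)"] by simp
    from bspec[OF this ij(1)] show False using ij(4) by simp
  qed
  show "independent (e ` I)"
  proof (rule independent_if_scalars_zero)
    fix c x assume "(\<Sum>x\<in>e ` I. c x *\<^sub>R x) = 0" "x \<in> e ` I"
    then show "c x = 0" using spec[OF assms(2), of "\<lambda>i. c (e i)"] by (auto simp: sum.reindex[OF inj])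
  qed (use assms(1) in simp)
qed

text \<open>The cut-off partial derivatives at p form such a basis: evaluation on cut-off
  coordinates gives independence, Hadamard's lemma gives spanning. That the basis consists of values
  of global fields is what later extends every tangent vector.\<close>

lemma tangent_basis_exists:
  fixes A :: "('m::{t2_space,second_countable_topology}, 'e::euclidean_space) chart set"
  assumes A: "smooth_atlas A"
  shows "\<exists>B. finite B \<and> card B = DIM('e) \<and> independent B \<and> span B = tangent_space A p \<and>
    B \<subseteq> (\<lambda>X. X p) ` vector_fields A"
proof -
  obtain U \<phi> R where U: "(U, \<phi>) \<in> A" "p \<in> U" "R > 0" "ball (\<phi> p) R \<subseteq> \<phi> ` U"
    using chart_ball_exists[OF A] by blast
  define x0 where "x0 = \<phi> p"
  have cb: "cball x0 (R / 2) \<subseteq> ball x0 R" using U(3) by auto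
  then have cbU: "cball x0 (R / 2) \<subseteq> \<phi> ` U" using U(4) by (auto simp: x0_def)
  obtain b :: "'e \<Rightarrow> real" where b: "smooth_on UNIV b" "b x0 > 0" "\<And>x. x \<notin> cball x0 (R / 2) \<Longrightarrow> b x = 0"
    using bump_exists[of "R / 2" x0] U(3) by auto
  define E where "E = chart_field A U \<phi> b"
  have E: "E i \<in> vector_fields A" for i
    unfolding E_def by (rule chart_field_in_vector_fields[OF A U(1) b(1) cbU b(3)])
  have oU: "open (\<phi> ` U)" using smooth_atlas_chart[OF A U(1)] by blast
  have inv: "inv_into U \<phi> (\<phi> q) = q" if "q \<in> U" for q
    using that smooth_atlas_chart(4)[OF A U(1)] by simp
  \<comment> \<open>Cut-off coordinates centred at p. The bump need not equal 1 at its centre, hence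
    the factors \<open>(b x0)\<^sup>2\<close> below.\<close>
  define y where "y = (\<lambda>i. chart_extend U \<phi> (\<lambda>x. b x * ((x - x0) \<bullet> i)))"
  define c where "c = chart_extend U \<phi> b"
  have smb: "chart_extend U \<phi> (\<lambda>x. b x * u x) \<in> smooth_functions A" if "smooth_on (ball x0 R) u" for u
  proof -
    have "smooth_on (ball x0 R) (\<lambda>x. b x * u x)"
      by (intro smooth_on_mult open_ball that smooth_on_subset[OF b(1)]) auto
    then have "smooth_on UNIV (\<lambda>x. b x * u x)"
      by (rule smooth_on_extend_zero[OF open_ball _ closed_cball cb]) (simp add: b(3))
    then show ?thesis
      by (intro smooth_functions_chart_extend[OF A U(1) smooth_on_subset[OF _ subset_UNIV] cbU])
        (simp_all add: b(3) del: mem_cball)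
  qed
  have smc: "c \<in> smooth_functions A"
    using smb[OF smooth_on_const[OF open_ball], of 1] by (simp add: c_def)
  have "smooth_on (ball x0 R) (\<lambda>x. (x - x0) \<bullet> i)" for i
    using smooth_on_add[OF open_ball smooth_on_bounded_linear[OF bounded_linear_inner_left open_ball]
        smooth_on_const[OF open_ball], of x0 R i "- (x0 \<bullet> i)"]
    by (simp add: inner_diff_left)
  then have smy: "y i \<in> smooth_functions A" for i
    unfolding y_def by (rule smb)
  have Ey: "E i p (y j) = (b x0)\<^sup>2 * (i \<bullet> j)" for i j
  proof -
    \<comment> \<open>The term containing the derivative of \<open>b\<close> carries the factor x0 -
      x0 and drops out.\<close>
    have "((\<lambda>x. b x * ((x - x0) \<bullet> j)) has_derivative
        (\<lambda>h. b x0 * (h \<bullet> j) + frechet_derivative b (at x0) h * ((x0 - x0) \<bullet> j))) (at x0)"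
      by (intro has_derivative_mult smooth_on_has_derivative[OF b(1)] derivative_eq_intros) auto
    then have "((\<lambda>x. y j (inv_into U \<phi> x)) has_derivative
        (\<lambda>h. b x0 * (h \<bullet> j) + frechet_derivative b (at x0) h * ((x0 - x0) \<bullet> j))) (at x0)"
      by (rule has_derivative_transform_within_open[OF _ oU])
        (use U(2) in \<open>auto simp: x0_def inv y_def chart_extend_def\<close>)
    from frechet_derivative_at[OF this, symmetric]
    show ?thesis
      using smy U(2) by (simp add: E_def chart_field_def chart_extend_def power2_eq_square flip: x0_def)
  qed
  have span: "v \<in> span ((\<lambda>i. E i p) ` Basis)" if v: "v \<in> tangent_space A p" for v
  proof -
    \<comment> \<open>The coefficients are forced by \<open>Ey\<close>: the fields pair with the
      functions \<open>y i\<close> as \<open>(b x0)\<^sup>2\<close> times the identity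
      matrix.\<close>
    have "v f = (\<Sum>i\<in>Basis. (v (y i) / (b x0)\<^sup>2) * E i p f)" if f: "f \<in> smooth_functions A" for f
    proof -
      let ?F = "\<lambda>x. f (inv_into U \<phi> x)"
      have F: "smooth_on (ball x0 R) ?F"
        using smooth_on_subset[OF smooth_functionsD[OF f U(1)]] U(4) by (simp add: x0_def)
      from hadamard[OF F U(3)] obtain G where
        G: "\<And>i. smooth_on (ball x0 R) (G i)" "\<And>i. G i x0 = frechet_derivative ?F (at x0) i"
          "\<And>x. x \<in> ball x0 R \<Longrightarrow> ?F x = ?F x0 + (\<Sum>i\<in>Basis. ((x - x0) \<bullet> i) * G i x)"
        by blast
      define h where "h = (\<lambda>i. chart_extend U \<phi> (\<lambda>x. b x * G i x))"
      have smh: "h i \<in> smooth_functions A" for i unfolding h_def by (rule smb[OF G(1)])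
      \<comment> \<open>Hadamard's identity holds only near p. One bump factor for
        \<open>y i\<close> and one for \<open>h i\<close> turn it into an identity of global smooth
        functions, both sides vanishing off the ball.\<close>
      have eq: "(\<lambda>q. c q * (c q * (f q + - f p))) = (\<lambda>q. \<Sum>i\<in>Basis. y i q * h i q)"
      proof
        fix q
        show "c q * (c q * (f q + - f p)) = (\<Sum>i\<in>Basis. y i q * h i q)"
        proof (cases "q \<in> U \<and> \<phi> q \<in> cball x0 (R / 2)")
          case True
          then have "f q = f p + (\<Sum>i\<in>Basis. ((\<phi> q - x0) \<bullet> i) * G i (\<phi> q))"
            using G(3)[of "\<phi> q"] cb inv U(2) by (auto simp: x0_def simp del: mem_ball mem_cball)
          then show ?thesis
            using True
            by (simp add: c_def y_def h_def chart_extend_def sum_distrib_left mult_ac del: mem_ball mem_cball)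
        next
          case False
          then show ?thesis
            using b(3)[of "\<phi> q"] by (auto simp: c_def y_def h_def chart_extend_def simp del: mem_ball mem_cball)
        qed
      qed
      have smf: "(\<lambda>q. f q + - f p) \<in> smooth_functions A"
        by (intro smooth_functions_add smooth_functions_const A f)
      have cp: "c p = b x0" "y i p = 0" "h i p = b x0 * G i x0" for i
        using U(2) by (simp_all add: c_def y_def h_def chart_extend_def x0_def)
      \<comment> \<open>The Leibniz terms that differentiate \<open>c\<close> vanish because f - f p
        is zero at p; on the right, those that differentiate \<open>h i\<close> vanish because
        \<open>y i\<close> is zero at p.\<close>
      have "v (\<lambda>q. c q * (c q * (f q + - f p))) = b x0 * (b x0 * v f)"
        by (simp add: tangent_space_mult[OF v] smc smf smooth_functions_mult[OF A] cp
            tangent_space_add[OF v f smooth_functions_const[OF A]] tangent_space_const[OF A v]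
            del: add_uminus_conv_diff)
      moreover have "v (\<lambda>q. \<Sum>i\<in>Basis. y i q * h i q) = (\<Sum>i\<in>Basis. b x0 * G i x0 * v (y i))"
        by (simp add: tangent_space_sum[OF A v] smooth_functions_mult[OF A] smy smh
            tangent_space_mult[OF v] cp)
      ultimately have "b x0 * (b x0 * v f) = (\<Sum>i\<in>Basis. b x0 * G i x0 * v (y i))"
        using eq by simp
      then have "v f = (\<Sum>i\<in>Basis. b x0 * G i x0 * v (y i)) / (b x0)\<^sup>2"
        using b(2) by (simp add: field_simps power2_eq_square)
      also have "\<dots> = (\<Sum>i\<in>Basis. (v (y i) / (b x0)\<^sup>2) * E i p f)"
        using f U(2) by (simp add: sum_divide_distrib E_def chart_field_def chart_extend_def G(2) mult_ac flip: x0_def)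
      finally show ?thesis .
    qed
    moreover have "v f = 0" "E i p f = 0" if "f \<notin> smooth_functions A" for f i
      using v that by (auto simp: tangent_space_def E_def chart_field_def)
    ultimately have eq: "(\<Sum>i\<in>Basis. (v (y i) / (b x0)\<^sup>2) *\<^sub>R E i p) f = v f" for f
      by (cases "f \<in> smooth_functions A") (simp_all add: sum_fun_apply scaleR_fun_def)
    have "(\<Sum>i\<in>Basis. (v (y i) / (b x0)\<^sup>2) *\<^sub>R E i p) \<in> span ((\<lambda>i. E i p) ` Basis)"
      by (intro span_sum span_scale span_base) auto
    moreover have "(\<Sum>i\<in>Basis. (v (y i) / (b x0)\<^sup>2) *\<^sub>R E i p) = v"
      using eq by (rule ext)
    ultimately show ?thesis by simp
  qed
  have scalars: "a j = 0" if "(\<Sum>i\<in>Basis. a i *\<^sub>R E i p) = 0" and j: "j \<in> Basis" for a :: "'e \<Rightarrow> real" and j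
  proof -
    have "(\<Sum>i\<in>Basis. a i *\<^sub>R E i p) (y j) = 0" using that(1) by simp
    then have "(\<Sum>i\<in>Basis. a i * ((b x0)\<^sup>2 * (i \<bullet> j))) = 0"
      by (simp add: sum_fun_apply scaleR_fun_def Ey)
    also have "(\<Sum>i\<in>Basis. a i * ((b x0)\<^sup>2 * (i \<bullet> j))) = (\<Sum>i\<in>Basis. if i = j then a i * (b x0)\<^sup>2 else 0)"
      by (rule sum.cong) (use j in \<open>auto simp: inner_Basis\<close>)
    finally show ?thesis using j b(2) by simp
  qed
  then have "\<forall>a. (\<Sum>i\<in>Basis. a i *\<^sub>R E i p) = 0 \<longrightarrow> (\<forall>j\<in>Basis. a j = 0)" by blast
  note ind = independent_family[OF finite_Basis this]
  have sub: "(\<lambda>i. E i p) ` Basis \<subseteq> (\<lambda>X. X p) ` vector_fields A" using E by blast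
  also have "\<dots> \<subseteq> tangent_space A p" by (auto simp: vector_fields_def)
  finally have "span ((\<lambda>i. E i p) ` Basis) \<subseteq> tangent_space A p"
    by (rule span_minimal[OF _ subspace_tangent_space])
  then have "span ((\<lambda>i. E i p) ` Basis) = tangent_space A p" using span by blast
  with ind sub show ?thesis
    by (intro exI[of _ "(\<lambda>i. E i p) ` Basis"]) (simp add: card_image)
qed

text \<open>The values at p of vector fields form a linear subspace that contains a basis of the
  tangent space, so the choice in \<open>extend_vector\<close> succeeds.\<close>

lemma extend_vector:
  fixes A :: "('m::{t2_space,second_countable_topology}, 'e::euclidean_space) chart set"
  assumes "smooth_atlas A" "v \<in> tangent_space A p"
  shows "extend_vector A p v \<in> vector_fields A" "extend_vector A p v p = v"
proof -
  from tangent_basis_exists[OF assms(1), of p] obtain B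
    where B: "finite B \<and> card B = DIM('e) \<and> independent B \<and> span B = tangent_space A p \<and>
      B \<subseteq> (\<lambda>X. X p) ` vector_fields A" ..
  have "linear (\<lambda>X :: 'm field. X p)" by (rule linearI) (auto simp: scaleR_fun_def)
  then have "subspace ((\<lambda>X. X p) ` vector_fields A)"
    by (rule linear_subspace_image[OF _ subspace_vector_fields[OF assms(1)]])
  then have "v \<in> (\<lambda>X. X p) ` vector_fields A"
    using span_minimal[of B] assms(2) B by auto
  then have "\<exists>X. X \<in> vector_fields A \<and> X p = v" by blast
  from someI_ex[OF this] show "extend_vector A p v \<in> vector_fields A" "extend_vector A p v p = v"
    by (auto simp: extend_vector_def)
qed

section \<open>Curvature of a torse-forming almost Riemann soliton\<close>

lemma trace_on_basis:
  assumes "subspace S"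
  obtains B where "independent B" "span B = S" "\<And>F. trace_on S F = (\<Sum>b\<in>B. representation B (F b) b)"
proof -
  obtain B where "B \<subseteq> S" "independent B" "S \<subseteq> span B"
    using maximal_independent_subset by blast
  then have "\<exists>B. independent B \<and> span B = S"
    using span_minimal[OF _ assms] by (intro exI[of _ B]) auto
  \<comment> \<open>The chosen basis depends on S alone, so the same one serves all endomorphisms
    and their traces can be added.\<close>
  then have "independent (SOME B. independent B \<and> span B = S)" "span (SOME B. independent B \<and> span B = S) = S"
    by (metis (mono_tags, lifting) someI_ex)+
  then show ?thesis by (rule that) (simp add: trace_on_def Let_def)
qed

lemma trace_on_cong:
  assumes "subspace S" "\<And>v. v \<in> S \<Longrightarrow> F v = G v"
  shows "trace_on S F = trace_on S G"
proof -
  obtain B where B: "span B = S" "\<And>F. trace_on S F = (\<Sum>b\<in>B. representation B (F b) b)"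
    using trace_on_basis[OF assms(1)] by blast
  then have "B \<subseteq> S" using span_superset by blast
  then show ?thesis using assms(2) by (auto simp: B(2) intro!: sum.cong)
qed

lemma trace_on_add:
  assumes "subspace S" "\<And>v. v \<in> S \<Longrightarrow> F v \<in> S" "\<And>v. v \<in> S \<Longrightarrow> G v \<in> S"
  shows "trace_on S (\<lambda>v. F v + G v) = trace_on S F + trace_on S G"
proof -
  obtain B where B: "independent B" "span B = S" "\<And>F. trace_on S F = (\<Sum>b\<in>B. representation B (F b) b)"
    using trace_on_basis[OF assms(1)] by blast
  then have "B \<subseteq> S" using span_superset by blast
  then have "representation B (F b + G b) b = representation B (F b) b + representation B (G b) b" if "b \<in> B" for b
    using that assms(2,3) B(1,2) by (subst representation_add) auto
  then show ?thesis by (simp add: B(3) sum.distrib)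
qed

lemma trace_on_scaleR:
  assumes "subspace S"
  shows "trace_on S (\<lambda>v. c *\<^sub>R v) = c * dim S"
proof -
  obtain B where B: "independent B" "span B = S" "\<And>F. trace_on S F = (\<Sum>b\<in>B. representation B (F b) b)"
    using trace_on_basis[OF assms] by blast
  have "trace_on S (\<lambda>v. c *\<^sub>R v) = (\<Sum>b\<in>B. c)"
    unfolding B(3) using B(1)
    by (intro sum.cong refl) (simp add: representation_scale span_base representation_basis)
  also have "\<dots> = c * dim S"
    using dim_span_eq_card_independent[OF B(1)] B(2) by simp
  finally show ?thesis .
qed

text \<open>In the coordinates of w the trace is the sum of w_b \<phi>(b), which is \<phi>(w).
  Linearity is asked on S only, since the metric is bilinear only on tangent spaces; the spanning
  set T forces the chosen basis to be finite.\<close>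

lemma trace_on_rank_one:
  assumes S: "subspace S" "finite T" "span T = S"
    and w: "w \<in> S"
    and \<phi>: "\<And>u v. u \<in> S \<Longrightarrow> v \<in> S \<Longrightarrow> \<phi> (u + v) = \<phi> u + \<phi> v" "\<And>c u. u \<in> S \<Longrightarrow> \<phi> (c *\<^sub>R u) = c * \<phi> u"
  shows "trace_on S (\<lambda>v. \<phi> v *\<^sub>R w) = \<phi> w"
proof -
  obtain B where B: "independent B" "span B = S" "\<And>F. trace_on S F = (\<Sum>b\<in>B. representation B (F b) b)"
    using trace_on_basis[OF S(1)] by blast
  have BS: "B \<subseteq> S" using span_superset B(2) by blast
  have fin: "finite B" using independent_span_bound[OF S(2) B(1)] S(3) BS by simp
  have \<phi>0: "\<phi> 0 = 0" using \<phi>(2)[of 0 0] subspace_0[OF S(1)] by simp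
  have sum: "\<phi> (\<Sum>b\<in>C. c b *\<^sub>R b) = (\<Sum>b\<in>C. c b * \<phi> b)" if "C \<subseteq> B" for C c
    using finite_subset[OF that fin] that
  proof (induction C rule: finite_induct)
    case (insert b C)
    then have "b \<in> S" "(\<Sum>b\<in>C. c b *\<^sub>R b) \<in> S"
      using BS by (auto intro!: subspace_sum S(1) subspace_scale)
    then show ?case using insert by (simp add: \<phi> subspace_scale[OF S(1)])
  qed (simp add: \<phi>0)
  have "trace_on S (\<lambda>v. \<phi> v *\<^sub>R w) = (\<Sum>b\<in>B. representation B w b * \<phi> b)"
    using w B(2) by (simp add: B(3) representation_scale[OF B(1)] mult.commute)
  also have "\<dots> = \<phi> (\<Sum>b\<in>B. representation B w b *\<^sub>R b)" using sum[OF subset_refl] by simp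
  also have "(\<Sum>b\<in>B. representation B w b *\<^sub>R b) = w"
    using w B(1,2) fin by (intro sum_representation_eq) auto
  finally show ?thesis .
qed

lemma metric_tensor_apply: "metric_tensor g X Y p = g p (X p) (Y p)"
  by (simp add: metric_tensor_def)

section \<open>Pointwise form of the metric, the connection and the curvature\<close>

locale torse_forming_soliton =
  fixes A :: "('m::{t2_space,second_countable_topology}, 'e::euclidean_space) chart set"
    and g :: "'m metric"
    and D :: "'m connection"
    and V \<zeta> :: "'m field"
    and \<psi> :: "'m \<Rightarrow> 'm tangent_vector \<Rightarrow> real"
    and l a :: "'m \<Rightarrow> real"
  assumes atlas: "smooth_atlas A"
    and metric: "riemannian_metric A g"
    and levi_civita: "levi_civita A g D"
    and soliton: "almost_riemann_soliton A g D V l"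
    and torse: "torse_forming A D V a \<psi>"
    and \<zeta>_field: "\<zeta> \<in> vector_fields A"
    and \<zeta>_dual: "\<forall>X\<in>vector_fields A. \<forall>p. metric_tensor g \<zeta> X p = \<psi> p (X p)"
begin

lemma V_field: "V \<in> vector_fields A"
  using soliton by (simp add: almost_riemann_soliton_def)

lemma field_tangent: "X \<in> vector_fields A \<Longrightarrow> X p \<in> tangent_space A p"
  by (simp add: vector_fields_def)

lemmas tangent_closed =
  subspace_add[OF subspace_tangent_space] subspace_scale[OF subspace_tangent_space]
  subspace_diff[OF subspace_tangent_space]

lemmas V_tangent = field_tangent[OF V_field]
lemmas \<zeta>_tangent = field_tangent[OF \<zeta>_field]

lemma g_sym: "u \<in> tangent_space A p \<Longrightarrow> v \<in> tangent_space A p \<Longrightarrow> g p u v = g p v u"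
  using metric unfolding riemannian_metric_def by blast

lemma g_pos: "u \<in> tangent_space A p \<Longrightarrow> u \<noteq> 0 \<Longrightarrow> g p u u > 0"
  using metric unfolding riemannian_metric_def by blast

lemma g_add_left:
  "u \<in> tangent_space A p \<Longrightarrow> v \<in> tangent_space A p \<Longrightarrow> w \<in> tangent_space A p \<Longrightarrow>
    g p (u + v) w = g p u w + g p v w"
  using metric unfolding riemannian_metric_def by blast

lemma g_scale_left:
  "u \<in> tangent_space A p \<Longrightarrow> v \<in> tangent_space A p \<Longrightarrow> g p (c *\<^sub>R u) v = c * g p u v"
  using metric unfolding riemannian_metric_def by blast

lemma g_diff_left:
  assumes "u \<in> tangent_space A p" "v \<in> tangent_space A p" "w \<in> tangent_space A p"
  shows "g p (u - v) w = g p u w - g p v w"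
  using g_add_left[OF assms(1) tangent_closed(2)[OF assms(2), of "-1"] assms(3)]
    g_scale_left[OF assms(2,3), of "-1"] by simp

lemma g_add_right:
  "u \<in> tangent_space A p \<Longrightarrow> v \<in> tangent_space A p \<Longrightarrow> w \<in> tangent_space A p \<Longrightarrow>
    g p w (u + v) = g p w u + g p w v"
  using g_add_left g_sym tangent_closed(1) by metis

lemma g_scale_right:
  "u \<in> tangent_space A p \<Longrightarrow> v \<in> tangent_space A p \<Longrightarrow> g p v (c *\<^sub>R u) = c * g p v u"
  using g_scale_left g_sym tangent_closed(2) by metis

lemma g_diff_right:
  "u \<in> tangent_space A p \<Longrightarrow> v \<in> tangent_space A p \<Longrightarrow> w \<in> tangent_space A p \<Longrightarrow>
    g p w (u - v) = g p w u - g p w v"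
  using g_diff_left g_sym tangent_closed(3) by metis

lemmas g_linear = g_add_left g_scale_left g_diff_left g_add_right g_scale_right g_diff_right

text \<open>Duality is given for vector fields and passes to a single tangent vector by extending
  it.\<close>

lemma \<psi>_eq:
  assumes "u \<in> tangent_space A p"
  shows "\<psi> p u = g p (\<zeta> p) u"
proof -
  note X = extend_vector[OF atlas assms]
  have "metric_tensor g \<zeta> (extend_vector A p u) p = \<psi> p (extend_vector A p u p)"
    using \<zeta>_dual X(1) by blast
  then show ?thesis by (simp add: metric_tensor_apply X(2))
qed

lemma D_field: "X \<in> vector_fields A \<Longrightarrow> Y \<in> vector_fields A \<Longrightarrow> D X Y \<in> vector_fields A"
  using levi_civita by (simp add: levi_civita_def affine_connection_def)

lemma D_V: "X \<in> vector_fields A \<Longrightarrow> D X V p = a p *\<^sub>R X p + g p (\<zeta> p) (X p) *\<^sub>R V p"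
  using torse \<psi>_eq[OF field_tangent] by (simp add: torse_forming_def)

lemma bracket: "X \<in> vector_fields A \<Longrightarrow> Y \<in> vector_fields A \<Longrightarrow> lie_bracket X Y = D X Y - D Y X"
  using levi_civita by (simp add: levi_civita_def)

lemma metric_compatible:
  "X \<in> vector_fields A \<Longrightarrow> Y \<in> vector_fields A \<Longrightarrow> Z \<in> vector_fields A \<Longrightarrow>
    X p (metric_tensor g Y Z) = g p (D X Y p) (Z p) + g p (Y p) (D X Z p)"
  using levi_civita by (simp add: levi_civita_def metric_tensor_def)

lemma curvature_field:
  "X \<in> vector_fields A \<Longrightarrow> Y \<in> vector_fields A \<Longrightarrow> Z \<in> vector_fields A \<Longrightarrow>
    curvature D X Y Z \<in> vector_fields A"
  unfolding curvature_def
  by (simp add: bracket subspace_diff[OF subspace_vector_fields[OF atlas]] D_field)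

text \<open>Half of the Lie derivative of the metric is \<open>a g + \<sigma>\<close>.\<close>

definition \<sigma> :: "'m \<Rightarrow> 'm tangent_vector \<Rightarrow> 'm tangent_vector \<Rightarrow> real" where
  "\<sigma> p x y = (g p (\<zeta> p) x * g p (V p) y + g p (V p) x * g p (\<zeta> p) y) / 2"

text \<open>Metric compatibility and vanishing torsion reduce the left side to g(\<nabla>_X V, Y) +
  g(X, \<nabla>_Y V), into which the torse-forming equation is substituted.\<close>

lemma lie_derivative_metric:
  assumes "X \<in> vector_fields A" "Y \<in> vector_fields A"
  shows "lie_derivative V (metric_tensor g) X Y p = 2 * (a p * g p (X p) (Y p) + \<sigma> p (X p) (Y p))"
proof -
  note f = assms[THEN field_tangent] V_tangent \<zeta>_tangent
    D_field[OF V_field assms(1), THEN field_tangent] D_field[OF V_field assms(2), THEN field_tangent]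
    D_field[OF assms(1) V_field, THEN field_tangent] D_field[OF assms(2) V_field, THEN field_tangent]
  have "lie_derivative V (metric_tensor g) X Y p = g p (D X V p) (Y p) + g p (X p) (D Y V p)"
    by (simp add: lie_derivative_def metric_compatible V_field assms bracket metric_tensor_apply g_linear f)
  also have "\<dots> = 2 * (a p * g p (X p) (Y p) + \<sigma> p (X p) (Y p))"
    by (simp add: D_V assms g_linear f tangent_closed \<sigma>_def g_sym[of "X p" p "V p"] field_simps)
  finally show ?thesis .
qed

text \<open>The vector whose inner product with w is (\<mu> G - \<sigma> \<odot> g)(x, y, z, w) for
  \<mu> = \<lambda> - 2 a: the soliton equation solved for the curvature, as an expression in
  tangent vectors at p.\<close>

definition curvature_form :: "'m \<Rightarrow> 'm tangent_vector \<Rightarrow> 'm tangent_vector \<Rightarrow> 'm tangent_vector \<Rightarrow> 'm tangent_vector"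
  where "curvature_form p x y z =
    ((l p - 2 * a p) * g p y z - \<sigma> p y z) *\<^sub>R x + (\<sigma> p x z - (l p - 2 * a p) * g p x z) *\<^sub>R y
    + ((g p x z * g p (\<zeta> p) y - g p y z * g p (\<zeta> p) x) / 2) *\<^sub>R V p
    + ((g p x z * g p (V p) y - g p y z * g p (V p) x) / 2) *\<^sub>R \<zeta> p"

lemma curvature_form_tangent:
  "x \<in> tangent_space A p \<Longrightarrow> y \<in> tangent_space A p \<Longrightarrow> curvature_form p x y z \<in> tangent_space A p"
  unfolding curvature_form_def by (intro tangent_closed V_tangent \<zeta>_tangent)

text \<open>The soliton equation shows that both sides have the same inner product with every field.
  Taking for W an extension of their difference, positivity makes the difference zero. In particular
  the curvature at p depends only on the values of the fields at p.\<close>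

lemma curvature_eq:
  assumes "X \<in> vector_fields A" "Y \<in> vector_fields A" "Z \<in> vector_fields A"
  shows "curvature D X Y Z p = curvature_form p (X p) (Y p) (Z p)"
proof -
  let ?u = "curvature D X Y Z p - curvature_form p (X p) (Y p) (Z p)"
  note f = assms[THEN field_tangent] V_tangent \<zeta>_tangent
  have C: "curvature D X Y Z p \<in> tangent_space A p"
    by (rule field_tangent[OF curvature_field[OF assms]])
  have F: "curvature_form p (X p) (Y p) (Z p) \<in> tangent_space A p"
    by (rule curvature_form_tangent[OF f(1,2)])
  have u: "?u \<in> tangent_space A p" by (rule tangent_closed(3)[OF C F])
  obtain W where W: "W \<in> vector_fields A" "W p = ?u"
    using extend_vector[OF atlas u] by blast
  note fW = field_tangent[OF W(1)]
  have "kulkarni_nomizu (\<lambda>X Y p. 1 / 2 * lie_derivative V (metric_tensor g) X Y p) (metric_tensor g) X Y Z W p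
      + curvature_tensor g D X Y Z W p
      = l p * (1 / 2 * kulkarni_nomizu (metric_tensor g) (metric_tensor g) X Y Z W p)"
    using soliton assms W(1) unfolding almost_riemann_soliton_def by blast
  then have "g p (curvature D X Y Z p) (W p) = g p (curvature_form p (X p) (Y p) (Z p)) (W p)"
    by (simp add: kulkarni_nomizu_def curvature_tensor_def lie_derivative_metric assms W(1) metric_tensor_apply
        curvature_form_def g_linear f fW tangent_closed)
      (simp add: \<sigma>_def field_simps)
  then have "g p ?u (W p) = 0" by (simp only: g_diff_left[OF C F fW])
  then have "g p ?u ?u = 0" by (simp only: W(2))
  then show ?thesis using g_pos[OF u] by force
qed

text \<open>As a map of its first argument, \<open>curvature_form\<close> is a multiple of the
  identity plus three maps of rank one, in the directions Y, V and \<zeta>; the identity part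
  contributes the dimension to the trace.\<close>

lemma ricci_eq:
  assumes "Y \<in> vector_fields A" "Z \<in> vector_fields A"
  shows "ricci A D Y Z p =
    ((l p - 2 * a p) * (real DIM('e) - 1) - g p (V p) (\<zeta> p)) * g p (Y p) (Z p) - (real DIM('e) - 2) * \<sigma> p (Y p) (Z p)"
proof -
  let ?S = "tangent_space A p"
  note f = assms[THEN field_tangent] V_tangent \<zeta>_tangent
  note S = subspace_tangent_space[of A p]
  obtain T where T: "finite T" "span T = ?S" "card T = DIM('e)" "independent T"
    using tangent_basis_exists[OF atlas, of p] by blast
  have dim: "dim ?S = DIM('e)" using dim_span_eq_card_independent[OF T(4)] T(2,3) by simp
  let ?c = "(l p - 2 * a p) * g p (Y p) (Z p) - \<sigma> p (Y p) (Z p)"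
  let ?\<beta> = "\<lambda>v. \<sigma> p v (Z p) - (l p - 2 * a p) * g p v (Z p)"
  let ?\<gamma> = "\<lambda>v. (g p v (Z p) * g p (\<zeta> p) (Y p) - g p (Y p) (Z p) * g p (\<zeta> p) v) / 2"
  let ?\<delta> = "\<lambda>v. (g p v (Z p) * g p (V p) (Y p) - g p (Y p) (Z p) * g p (V p) v) / 2"
  have "ricci A D Y Z p = trace_on ?S (\<lambda>v. ?c *\<^sub>R v + ?\<beta> v *\<^sub>R Y p + ?\<gamma> v *\<^sub>R V p + ?\<delta> v *\<^sub>R \<zeta> p)"
    unfolding ricci_def
    by (rule trace_on_cong[OF S]) (simp add: curvature_eq extend_vector[OF atlas] assms curvature_form_def)
  also have "\<dots> = trace_on ?S (\<lambda>v. ?c *\<^sub>R v) + trace_on ?S (\<lambda>v. ?\<beta> v *\<^sub>R Y p)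
      + trace_on ?S (\<lambda>v. ?\<gamma> v *\<^sub>R V p) + trace_on ?S (\<lambda>v. ?\<delta> v *\<^sub>R \<zeta> p)"
    by (simp add: trace_on_add[OF S] tangent_closed f)
  also have "trace_on ?S (\<lambda>v. ?c *\<^sub>R v) = ?c * DIM('e)"
    by (simp only: trace_on_scaleR[OF S] dim)
  also have "trace_on ?S (\<lambda>v. ?\<beta> v *\<^sub>R Y p) = ?\<beta> (Y p)"
    by (rule trace_on_rank_one[OF S T(1,2) f(1)]) (simp_all add: \<sigma>_def g_linear f field_simps)
  also have "trace_on ?S (\<lambda>v. ?\<gamma> v *\<^sub>R V p) = ?\<gamma> (V p)"
    by (rule trace_on_rank_one[OF S T(1,2) f(3)]) (simp_all add: g_linear f field_simps)
  also have "trace_on ?S (\<lambda>v. ?\<delta> v *\<^sub>R \<zeta> p) = ?\<delta> (\<zeta> p)"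
    by (rule trace_on_rank_one[OF S T(1,2) f(4)]) (simp_all add: g_linear f field_simps)
  finally show ?thesis
    by (simp add: \<sigma>_def g_sym[OF f(4,3)] field_simps)
qed

section \<open>Consequences of the curvature condition on Ric\<close>

lemma orthogonal_tangent_exists:
  assumes "DIM('e) \<ge> 3" "(g p (V p) (\<zeta> p))\<^sup>2 \<noteq> g p (V p) (V p) * g p (\<zeta> p) (\<zeta> p)"
  shows "\<exists>e\<in>tangent_space A p. e \<noteq> 0 \<and> g p (V p) e = 0 \<and> g p (\<zeta> p) e = 0"
proof -
  obtain T where T: "span T = tangent_space A p" "card T = DIM('e)" "independent T"
    using tangent_basis_exists[OF atlas, of p] by blast
  \<comment> \<open>Two vectors span at most a plane, while the dimension is at least 3.\<close>
  have "\<not> T \<subseteq> span {V p, \<zeta> p}"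
  proof
    assume "T \<subseteq> span {V p, \<zeta> p}"
    then have "card T \<le> card {V p, \<zeta> p}" using independent_span_bound[of "{V p, \<zeta> p}" T] T(3) by simp
    also have "\<dots> \<le> 2" by (simp add: card_insert_if)
    finally show False using T(2) assms(1) by simp
  qed
  then obtain u where u: "u \<in> T" "u \<notin> span {V p, \<zeta> p}" by (meson subsetI)
  then have uS: "u \<in> tangent_space A p" using T(1) span_base[OF u(1)] by simp
  let ?N = "g p (V p) (V p)" and ?q = "g p (\<zeta> p) (\<zeta> p)" and ?s = "g p (V p) (\<zeta> p)"
  \<comment> \<open>The Gram determinant of V and \<zeta>. By Cramer's rule x and y are the
    coordinates of the orthogonal projection of u to the plane of V and \<zeta>, and e is what
    remains of u.\<close>
  define d where "d = ?N * ?q - ?s\<^sup>2"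
  define x where "x = (?q * g p (V p) u - ?s * g p (\<zeta> p) u) / d"
  define y where "y = (?N * g p (\<zeta> p) u - ?s * g p (V p) u) / d"
  define e where "e = u - (x *\<^sub>R V p + y *\<^sub>R \<zeta> p)"
  note f = uS V_tangent[of p] \<zeta>_tangent[of p]
  have d: "d \<noteq> 0" using assms(2) by (simp add: d_def)
  have "e \<noteq> 0"
  proof
    assume "e = 0"
    then have "u = x *\<^sub>R V p + y *\<^sub>R \<zeta> p" by (simp add: e_def)
    then show False using u(2) by (metis span_add span_base span_scale insertCI)
  qed
  moreover have "e \<in> tangent_space A p" unfolding e_def by (intro tangent_closed f)
  moreover have "d * g p (V p) e = 0" "d * g p (\<zeta> p) e = 0"
    unfolding e_def using d
    by (simp_all add: g_linear f tangent_closed g_sym[OF f(3,2)] x_def y_def add_divide_distrib[symmetric]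
        right_diff_distrib)
      (simp_all add: d_def power2_eq_square algebra_simps)
  ultimately show ?thesis using d by auto
qed

lemma potential_parallel_dual:
  assumes "DIM('e) \<ge> 3"
    and semisym: "\<forall>X\<in>vector_fields A. \<forall>Y\<in>vector_fields A. \<forall>Z\<in>vector_fields A. \<forall>p.
      ricci A D (curvature D V X Y) Z p + ricci A D Y (curvature D V X Z) p = 0"
  shows "(g p (V p) (\<zeta> p))\<^sup>2 = g p (V p) (V p) * g p (\<zeta> p) (\<zeta> p)"
proof (rule ccontr)
  assume neq: "(g p (V p) (\<zeta> p))\<^sup>2 \<noteq> g p (V p) (V p) * g p (\<zeta> p) (\<zeta> p)"
  from orthogonal_tangent_exists[OF assms(1) neq] obtain e where
    e: "e \<in> tangent_space A p" "e \<noteq> 0" "g p (V p) e = 0" "g p (\<zeta> p) e = 0"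
    by blast
  obtain X where X: "X \<in> vector_fields A" "X p = e"
    using extend_vector[OF atlas e(1)] by blast
  note f = e(1) V_tangent[of p] \<zeta>_tangent[of p]
  define N where "N = g p (V p) (V p)"
  define q where "q = g p (\<zeta> p) (\<zeta> p)"
  define s where "s = g p (V p) (\<zeta> p)"
  define E where "E = g p e e"
  \<comment> \<open>Chosen so that R(V, e) e = E (k V - (N / 2) \<zeta>).\<close>
  define k where "k = l p - 2 * a p - s / 2"
  define \<kappa> where "\<kappa> = (l p - 2 * a p) * (real DIM('e) - 1) - s"
  define n where "n = real DIM('e) - 2"
  have E: "E > 0" and N: "N > 0"
    using g_pos e(1,2) V_tangent soliton by (auto simp: E_def N_def almost_riemann_soliton_def)
  have n: "n > 0" using assms(1) by (simp add: n_def)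
  have sym: "g p e (V p) = 0" "g p e (\<zeta> p) = 0" "g p (\<zeta> p) (V p) = s"
    using g_sym f e(3,4) by (auto simp: s_def)
  have ric: "ricci A D Y Z p = \<kappa> * g p (Y p) (Z p) - n * \<sigma> p (Y p) (Z p)"
    if "Y \<in> vector_fields A" "Z \<in> vector_fields A" for Y Z
    unfolding \<kappa>_def n_def s_def by (rule ricci_eq[OF that])
  \<comment> \<open>As e is orthogonal to V and \<zeta>, every \<sigma>(e, .) vanishes, and R(V, e)
    e stays in the plane of V and \<zeta>.\<close>
  have RXX: "curvature D V X X p = (E * k) *\<^sub>R V p - (E * N / 2) *\<^sub>R \<zeta> p"
    by (simp add: curvature_eq X V_field curvature_form_def \<sigma>_def e sym algebra_simps
        flip: E_def N_def scaleR_left_distrib)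
      (simp add: k_def field_simps flip: scaleR_left_distrib)
  have RXZ: "curvature D V X Z p = (\<sigma> p (V p) (Z p) - (k + s / 2) * g p (V p) (Z p)) *\<^sub>R e"
    if "Z \<in> vector_fields A" "g p e (Z p) = 0" for Z
    by (simp add: curvature_eq X V_field that curvature_form_def \<sigma>_def e k_def)
  \<comment> \<open>The multiple \<kappa> g of the metric in Ric cancels, as R(V, e) is skew for g.
    Only the \<sigma> part is left, with the common factor E n, which is positive.\<close>
  have main: "k * \<sigma> p (V p) (Z p) = N / 2 * \<sigma> p (\<zeta> p) (Z p)"
    if Z: "Z \<in> vector_fields A" "g p e (Z p) = 0" for Z
  proof -
    note fZ = field_tangent[OF Z(1), of p]
    have "ricci A D (curvature D V X X) Z p + ricci A D X (curvature D V X Z) p = 0"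
      using semisym X(1) Z(1) by blast
    moreover have "ricci A D (curvature D V X X) Z p + ricci A D X (curvature D V X Z) p
        = - (E * n * (k * \<sigma> p (V p) (Z p) - N / 2 * \<sigma> p (\<zeta> p) (Z p)))"
      by (simp add: ric curvature_field V_field X Z RXX RXZ \<sigma>_def g_linear f fZ tangent_closed e sym
          flip: E_def N_def s_def q_def)
        (simp add: field_simps)
    ultimately show ?thesis using E n by simp
  qed
  \<comment> \<open>The two choices Z = V and Z = \<zeta> give two equations for the single unknown
    k.\<close>
  have "N * (4 * k * s) = N * (s\<^sup>2 + N * q)"
    using main[OF V_field sym(1)]
    by (simp add: \<sigma>_def sym power2_eq_square field_simps flip: N_def s_def q_def)
  then have 1: "4 * k * s = s\<^sup>2 + N * q" using N by simp
  have 2: "k * (s\<^sup>2 + N * q) = N * q * s"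
    using main[OF \<zeta>_field sym(2)]
    by (simp add: \<sigma>_def sym power2_eq_square field_simps flip: N_def s_def q_def)
  \<comment> \<open>Elimination of k: one factor s^2 + N q is replaced by means of \<open>1\<close>,
    the product N q s by means of \<open>2\<close>.\<close>
  have "(s\<^sup>2 - N * q)\<^sup>2 = (s\<^sup>2 + N * q) * (s\<^sup>2 + N * q) - 4 * (N * q * s) * s"
    by (simp add: power2_eq_square algebra_simps)
  also have "\<dots> = (s\<^sup>2 + N * q) * (4 * k * s) - 4 * (k * (s\<^sup>2 + N * q)) * s"
    unfolding 1 2 by simp
  also have "\<dots> = 0" by (simp add: algebra_simps)
  finally show False using neq by (simp add: s_def N_def q_def)
qed

text \<open>Positivity of the metric is given for nonzero vectors; for the zero vector homogeneity
  yields 0.\<close>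

lemma metric_norm_squared: "u \<in> tangent_space A p \<Longrightarrow> (metric_norm g p u)\<^sup>2 = g p u u"
  using g_pos[of u p] g_scale_left[of 0 p 0 0] subspace_0[OF subspace_tangent_space, of A p]
  by (cases "u = 0") (auto simp: metric_norm_def)

text \<open>Here V(g(V, V)) = 2 g(\<nabla>_V V, V), and the torse-forming equation makes \<nabla>_V
  V equal to (a + g(V, \<zeta>)) V.\<close>

lemma derivative_norm_squared:
  "1 / 2 * (V p (\<lambda>q. (metric_norm g q (V q))\<^sup>2) / (metric_norm g p (V p))\<^sup>2) = a p + g p (V p) (\<zeta> p)"
proof -
  note f = V_tangent[of p] \<zeta>_tangent[of p]
  have "(\<lambda>q. (metric_norm g q (V q))\<^sup>2) = metric_tensor g V V"
    by (simp add: metric_norm_squared V_tangent metric_tensor_def)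
  then have "V p (\<lambda>q. (metric_norm g q (V q))\<^sup>2) = 2 * (a p + g p (V p) (\<zeta> p)) * g p (V p) (V p)"
    by (simp add: metric_compatible V_field D_V g_linear f tangent_closed g_sym[OF f(2,1)] algebra_simps)
  moreover have "g p (V p) (V p) > 0"
    using g_pos f(1) soliton by (auto simp: almost_riemann_soliton_def)
  ultimately show ?thesis by (simp add: metric_norm_squared f)
qed

end

theorem proposition2p19:
  fixes A :: "('m::{t2_space,second_countable_topology}, 'e::euclidean_space) chart set"
    and g :: "'m metric"
    and D :: "'m connection"
    and V \<zeta> :: "'m field"
    and \<psi> :: "'m \<Rightarrow> 'm tangent_vector \<Rightarrow> real"
    and l a :: "'m \<Rightarrow> real"
  assumes "DIM('e) \<ge> 3"
    and "smooth_atlas A"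
    and "riemannian_metric A g"
    and "levi_civita A g D"
    and "almost_riemann_soliton A g D V l"
    and "torse_forming A D V a \<psi>"
    and "\<zeta> \<in> vector_fields A"
    and "\<forall>X\<in>vector_fields A. \<forall>p. metric_tensor g \<zeta> X p = \<psi> p (X p)"
    and "\<forall>X\<in>vector_fields A. \<forall>Y\<in>vector_fields A. \<forall>Z\<in>vector_fields A. \<forall>p.
           ricci A D (curvature D V X Y) Z p + ricci A D Y (curvature D V X Z) p = 0"
  shows "(\<forall>p. l p = 1 / 2 * (V p (\<lambda>q. (metric_norm g q (V q))\<^sup>2) / (metric_norm g p (V p))\<^sup>2) + a p) \<or>
         (\<forall>p. a p = 1 / 2 * (V p (\<lambda>q. (metric_norm g q (V q))\<^sup>2) / (metric_norm g p (V p))\<^sup>2)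
                      + metric_norm g p (V p) * metric_norm g p (\<zeta> p) \<or>
              a p = 1 / 2 * (V p (\<lambda>q. (metric_norm g q (V q))\<^sup>2) / (metric_norm g p (V p))\<^sup>2)
                      - metric_norm g p (V p) * metric_norm g p (\<zeta> p))"
proof (rule disjI2, rule allI)
  fix p
  interpret torse_forming_soliton A g D V \<zeta> \<psi> l a
    by (rule torse_forming_soliton.intro) fact+
  \<comment> \<open>Since a is the quotient term minus g(V, \<zeta>), the sign in the conclusion is
    opposite to that of g(V, \<zeta>) at p and is chosen point by point.\<close>
  have "\<bar>g p (V p) (\<zeta> p)\<bar> = sqrt ((g p (V p) (\<zeta> p))\<^sup>2)" by simp
  also have "\<dots> = metric_norm g p (V p) * metric_norm g p (\<zeta> p)"
    using potential_parallel_dual[OF assms(1,9)] by (simp add: metric_norm_def real_sqrt_mult)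
  finally show "a p = 1 / 2 * (V p (\<lambda>q. (metric_norm g q (V q))\<^sup>2) / (metric_norm g p (V p))\<^sup>2)
        + metric_norm g p (V p) * metric_norm g p (\<zeta> p) \<or>
      a p = 1 / 2 * (V p (\<lambda>q. (metric_norm g q (V q))\<^sup>2) / (metric_norm g p (V p))\<^sup>2)
        - metric_norm g p (V p) * metric_norm g p (\<zeta> p)"
    unfolding derivative_norm_squared by linarith
qed

end
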